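(* For a short antichain $\Gamma$ of $\Delta^+$ let $I\langle\Gamma\rangle=\{\mu\in\Delta^+:\mu\succcurlyeq\gamma\text{ for some }\gamma\in\Gamma\}$ and \[R^{(s)}_\Gamma=\{x\in\mathcal C:(x,\mu)>1\text{ if }\mu\in I\langle\Gamma\rangle\cap\Delta^+_s,\ (x,\mu)<1\text{ if }\mu\in\Delta^+_s\setminus I\langle\Gamma\rangle\}.\] (i) For every short antichain $\Gamma$, $R^{(s)}_\Gamma$ is a dominant region of the semi-Catalan arrangement $\mathrm{Cat}_s(\Delta)$, and $\Gamma\mapsto R^{(s)}_\Gamma$ is a bijection from the set of short antichains of $\Delta^+$ onto the set of dominant regions of $\mathrm{Cat}_s(\Delta)$. (ii) $R^{(s)}_\Gamma$ is bounded if and only if $\Gamma$ is strictly $s$-positive, i.e. $\Gamma\subset\Delta^+_s\setminus\Pi(\Delta^+_s)$.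
   Context: $\Delta$ is an irreducible reduced crystallographic root system with two root lengths in a real Euclidean space $V$ with $W$-invariant inner product $(\cdot,\cdot)$; $\Delta^+$ positive roots, $\Pi$ simple roots, $\Delta^+_s,\Delta^+_l$ short/long positive roots; $\Pi(\Delta^+_s)$ is the set of simple roots of the root system $\Delta_s$ of short roots with respect to the positive system $\Delta^+_s$. $\mathcal C=\{x\in V:(x,\alpha)>0\ \forall\alpha\in\Pi\}$. On $\Delta^+$, $\mu\preccurlyeq\gamma$ iff $\gamma-\mu$ is a nonnegative integer combination of elements of $\Pi$; an antichain is a set of pairwise incomparable positive roots, short if all elements are short. For $\mu\in\Delta^+$, $k\in\mathbb Z$, $\mathcal H_{\mu,k}=\{x\in V:(x,\mu)=k\}$. The semi-Catalan arrangement $\mathrm{Cat}_s(\Delta)$ consists of the hyperplanes $\mathcal H_{\mu,k}$ ($\mu\in\Delta^+_s$, $k\in\{-1,0,1\}$) and $\mathcal H_{\nu,0}$ ($\nu\in\Delta^+_l$). Its regions are the connected components of the complement in $V$ of the union of these hyperplanes; a region is dominant if it lies in $\mathcal C$, and bounded if it is contained in some ball. *)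

theory Defs
  imports "HOL-Analysis.Analysis"
begin

text \<open>
  The ambient Euclidean space \<open>V\<close> is a type of class \<open>euclidean_space\<close>. Its inner product is
  invariant under the Weyl group because the latter is generated by reflections that are
  orthogonal with respect to that inner product.
\<close>

definition reflection :: "'a::euclidean_space \<Rightarrow> 'a \<Rightarrow> 'a"
  where "reflection \<alpha> x = x - (2 * (x \<bullet> \<alpha>) / (\<alpha> \<bullet> \<alpha>)) *\<^sub>R \<alpha>"

definition root_system :: "'a::euclidean_space set \<Rightarrow> bool"
  where "root_system \<Phi> \<longleftrightarrow>
    finite \<Phi> \<and> 0 \<notin> \<Phi> \<and> span \<Phi> = UNIV \<and>
    (\<forall>\<alpha>\<in>\<Phi>. reflection \<alpha> ` \<Phi> = \<Phi>)"

definition crystallographic :: "'a::euclidean_space set \<Rightarrow> bool"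
  where "crystallographic \<Phi> \<longleftrightarrow> (\<forall>\<alpha>\<in>\<Phi>. \<forall>\<beta>\<in>\<Phi>. 2 * (\<beta> \<bullet> \<alpha>) / (\<alpha> \<bullet> \<alpha>) \<in> \<int>)"

definition reduced_roots :: "'a::euclidean_space set \<Rightarrow> bool"
  where "reduced_roots \<Phi> \<longleftrightarrow> (\<forall>\<alpha>\<in>\<Phi>. \<forall>c::real. c *\<^sub>R \<alpha> \<in> \<Phi> \<longrightarrow> c = 1 \<or> c = -1)"

definition irreducible_roots :: "'a::euclidean_space set \<Rightarrow> bool"
  where "irreducible_roots \<Phi> \<longleftrightarrow> \<Phi> \<noteq> {} \<and>
    \<not> (\<exists>A B. A \<noteq> {} \<and> B \<noteq> {} \<and> A \<inter> B = {} \<and> A \<union> B = \<Phi> \<and> (\<forall>\<alpha>\<in>A. \<forall>\<beta>\<in>B. \<alpha> \<bullet> \<beta> = 0))"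

definition two_root_lengths :: "'a::euclidean_space set \<Rightarrow> bool"
  where "two_root_lengths \<Phi> \<longleftrightarrow> card (norm ` \<Phi>) = 2"

definition short_roots :: "'a::euclidean_space set \<Rightarrow> 'a set"
  where "short_roots \<Phi> = {\<alpha>\<in>\<Phi>. \<forall>\<beta>\<in>\<Phi>. norm \<alpha> \<le> norm \<beta>}"

definition long_roots :: "'a::euclidean_space set \<Rightarrow> 'a set"
  where "long_roots \<Phi> = {\<alpha>\<in>\<Phi>. \<forall>\<beta>\<in>\<Phi>. norm \<beta> \<le> norm \<alpha>}"

definition positive_system :: "'a::euclidean_space set \<Rightarrow> 'a set \<Rightarrow> bool"
  where "positive_system \<Phi> P \<longleftrightarrow>
    (\<exists>v. (\<forall>\<alpha>\<in>\<Phi>. v \<bullet> \<alpha> \<noteq> 0) \<and> P = {\<alpha>\<in>\<Phi>. v \<bullet> \<alpha> > 0})"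

text \<open>
  The simple roots of a positive system are its indecomposable elements. This depends on the
  positive system only, so the same function gives \<open>\<Pi>\<close> from \<open>\<Delta>\<^sup>+\<close> and \<open>\<Pi>(\<Delta>\<^sup>+\<^sub>s)\<close> from the positive
  system \<open>\<Delta>\<^sup>+\<^sub>s\<close> of \<open>\<Delta>\<^sub>s\<close>; in the latter case both summands range over short roots only.
\<close>

definition simple_roots :: "'a::euclidean_space set \<Rightarrow> 'a set"
  where "simple_roots P = {\<alpha>\<in>P. \<not> (\<exists>\<beta>\<in>P. \<exists>\<gamma>\<in>P. \<alpha> = \<beta> + \<gamma>)}"

definition pos_short :: "'a::euclidean_space set \<Rightarrow> 'a set \<Rightarrow> 'a set"
  where "pos_short \<Delta> P = P \<inter> short_roots \<Delta>"

definition pos_long :: "'a::euclidean_space set \<Rightarrow> 'a set \<Rightarrow> 'a set"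
  where "pos_long \<Delta> P = P \<inter> long_roots \<Delta>"

definition root_le :: "'a::euclidean_space set \<Rightarrow> 'a \<Rightarrow> 'a \<Rightarrow> bool"
  where "root_le P \<mu> \<gamma> \<longleftrightarrow>
    (\<exists>c::'a \<Rightarrow> nat. \<gamma> - \<mu> = (\<Sum>\<alpha>\<in>simple_roots P. real (c \<alpha>) *\<^sub>R \<alpha>))"

definition root_antichain :: "'a::euclidean_space set \<Rightarrow> 'a set \<Rightarrow> bool"
  where "root_antichain P \<Gamma> \<longleftrightarrow>
    \<Gamma> \<subseteq> P \<and> (\<forall>\<mu>\<in>\<Gamma>. \<forall>\<gamma>\<in>\<Gamma>. \<mu> \<noteq> \<gamma> \<longrightarrow> \<not> root_le P \<mu> \<gamma> \<and> \<not> root_le P \<gamma> \<mu>)"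

definition short_antichain :: "'a::euclidean_space set \<Rightarrow> 'a set \<Rightarrow> 'a set \<Rightarrow> bool"
  where "short_antichain \<Delta> P \<Gamma> \<longleftrightarrow> root_antichain P \<Gamma> \<and> \<Gamma> \<subseteq> short_roots \<Delta>"

definition upper_ideal :: "'a::euclidean_space set \<Rightarrow> 'a set \<Rightarrow> 'a set"
  where "upper_ideal P \<Gamma> = {\<mu>\<in>P. \<exists>\<gamma>\<in>\<Gamma>. root_le P \<gamma> \<mu>}"

definition strictly_s_positive :: "'a::euclidean_space set \<Rightarrow> 'a set \<Rightarrow> 'a set \<Rightarrow> bool"
  where "strictly_s_positive \<Delta> P \<Gamma> \<longleftrightarrow>
    \<Gamma> \<subseteq> pos_short \<Delta> P - simple_roots (pos_short \<Delta> P)"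

definition chamber :: "'a::euclidean_space set \<Rightarrow> 'a set"
  where "chamber P = {x. \<forall>\<alpha>\<in>simple_roots P. x \<bullet> \<alpha> > 0}"

definition root_hyperplane :: "'a::euclidean_space \<Rightarrow> int \<Rightarrow> 'a set"
  where "root_hyperplane \<mu> k = {x. x \<bullet> \<mu> = of_int k}"

definition semi_Catalan :: "'a::euclidean_space set \<Rightarrow> 'a set \<Rightarrow> 'a set set"
  where "semi_Catalan \<Delta> P =
    {root_hyperplane \<mu> k | \<mu> k. \<mu> \<in> pos_short \<Delta> P \<and> k \<in> {-1, 0, 1}} \<union>
    {root_hyperplane \<nu> 0 | \<nu>. \<nu> \<in> pos_long \<Delta> P}"

definition arrangement_regions :: "'a::euclidean_space set set \<Rightarrow> 'a set set"
  where "arrangement_regions \<A> = components (UNIV - \<Union>\<A>)"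

definition dominant_regions :: "'a::euclidean_space set \<Rightarrow> 'a set \<Rightarrow> 'a set set"
  where "dominant_regions \<Delta> P =
    {R \<in> arrangement_regions (semi_Catalan \<Delta> P). R \<subseteq> chamber P}"

definition s_region :: "'a::euclidean_space set \<Rightarrow> 'a set \<Rightarrow> 'a set \<Rightarrow> 'a set"
  where "s_region \<Delta> P \<Gamma> = {x \<in> chamber P.
    (\<forall>\<mu> \<in> upper_ideal P \<Gamma> \<inter> pos_short \<Delta> P. x \<bullet> \<mu> > 1) \<and>
    (\<forall>\<mu> \<in> pos_short \<Delta> P - upper_ideal P \<Gamma>. x \<bullet> \<mu> < 1)}"

end

theory Submission
  imports Defs
begin

text \<open>
  Everything rests on infeasibility certificates for linear systems. By Dirichlet approximation a
  linear relation with nonnegative real coefficients between vectors with integral coordinates can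
  be replaced by one with natural coefficients, so Farkas' lemma yields certificates of the form
  \<open>\<Sum>A + \<Sum>B = \<Sum>C\<close> for multisets of positive roots, where \<open>A\<close> is arbitrary, \<open>B\<close> lies in the ideal
  \<open>I\<langle>\<Gamma>\<rangle>\<close> and \<open>C\<close> consists of short roots outside it. If \<open>\<nu>\<close> is short, \<open>\<beta> \<noteq> \<nu>\<close> is a root and
  \<open>(\<nu>,\<beta>) > 0\<close>, then \<open>\<nu> - \<beta> = s\<^sub>\<beta>(\<nu>)\<close> is again a short root; this allows such relations to be
  shortened until nothing is left. With \<open>|C| \<le> |B|\<close> this shows that \<open>R\<^sup>(\<^sup>s\<^sup>)\<^sub>\<Gamma>\<close> is nonempty. With
  \<open>B = {\<theta>}\<close> for \<open>\<theta> \<in> \<Gamma> \<inter> \<Pi>(\<Delta>\<^sup>+\<^sub>s)\<close> it gives a nonzero dominant vector which is orthogonal to all short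
  positive roots outside the ideal, hence a ray in \<open>R\<^sup>(\<^sup>s\<^sup>)\<^sub>\<Gamma>\<close>.

  Conversely, the short roots in an interval of \<open>\<preccurlyeq>\<close> are linked by simple reflections, each of which
  preserves decomposability in \<open>\<Delta>\<^sup>+\<^sub>s\<close>. So if \<open>\<Gamma>\<close> is strictly \<open>s\<close>-positive, then no element of
  \<open>\<Pi>(\<Delta>\<^sup>+\<^sub>s)\<close> lies in the ideal, and the region is contained in the bounded set given by
  \<open>0 < (x,\<theta>) < 1\<close> for \<open>\<theta> \<in> \<Pi>(\<Delta>\<^sup>+\<^sub>s)\<close>, which spans \<open>V\<close> by irreducibility.
\<close>

section \<open>Integral Farkas alternatives\<close>

lemma Dirichlet_approx_simult_finite:
  fixes u :: "'i \<Rightarrow> real"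
  assumes "finite I" and "N > 0"
  obtains q :: int and p :: "'i \<Rightarrow> int"
    where "q > 0" and "\<And>i. i \<in> I \<Longrightarrow> \<bar>of_int q * u i - of_int (p i)\<bar> < 1 / real N"
proof -
  obtain h where h: "bij_betw h I {0..<card I}"
    using ex_bij_betw_finite_nat[OF \<open>finite I\<close>] by auto
  show thesis
  proof (rule Dirichlet_approx_simult[OF \<open>N > 0\<close>, of "card I" "u \<circ> inv_into I h"])
    fix q p
    assume q: "q > 0"
      and p: "\<And>j. j < card I \<Longrightarrow> \<bar>of_int q * (u \<circ> inv_into I h) j - of_int (p j)\<bar> < 1 / real N"
    show thesis
    proof (rule that[OF q, where p = "p \<circ> h"])
      fix i assume "i \<in> I"
      with h have "h i < card I" "inv_into I h (h i) = i"
        by (auto simp: bij_betw_def)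
      with p[of "h i"] show "\<bar>of_int q * u i - of_int ((p \<circ> h) i)\<bar> < 1 / real N"
        by simp
    qed
  qed
qed

text \<open>Simultaneous Dirichlet approximation replaces each \<open>q * u i\<close> by a nearby
  integer \<open>p i\<close>. The error in every relation is then below 1 in absolute value, and
  since the values of \<open>k\<close> are integers the perturbed sum is an integer, hence
  0.\<close>

lemma integral_relation_of_real_relation:
  fixes u :: "'i \<Rightarrow> real" and k :: "'i \<Rightarrow> 'f \<Rightarrow> real"
  assumes "finite I" and "finite F"
    and int: "\<And>i f. i \<in> I \<Longrightarrow> f \<in> F \<Longrightarrow> k i f \<in> \<int>"
    and u: "\<And>i. i \<in> I \<Longrightarrow> u i \<ge> 0"
    and rel: "\<And>f. f \<in> F \<Longrightarrow> (\<Sum>i\<in>I. u i * k i f) = 0"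
  obtains m :: "'i \<Rightarrow> nat"
    where "\<And>i. i \<in> I \<Longrightarrow> u i > 0 \<Longrightarrow> m i > 0"
      and "\<And>f. f \<in> F \<Longrightarrow> (\<Sum>i\<in>I. real (m i) * k i f) = 0"
proof -
  \<comment> \<open>The three summands make \<open>N\<close> larger than 1, than each
    \<open>(\<Sum>i\<in>I. \<bar>k i f\<bar>)\<close>, which controls the errors, and than each
    \<open>1 / u i\<close>, which keeps positive coefficients positive. Indices with
    \<open>u i = 0\<close> contribute \<open>1 / 0 = 0\<close>.\<close>
  define B where "B = 1 + (\<Sum>f\<in>F. \<Sum>i\<in>I. \<bar>k i f\<bar>) + (\<Sum>i\<in>I. 1 / u i)"
  obtain N where N: "real N > B"
    using reals_Archimedean2 by blast
  have nn: "(\<Sum>f\<in>F. \<Sum>i\<in>I. \<bar>k i f\<bar>) \<ge> 0" "(\<Sum>i\<in>I. 1 / u i) \<ge> 0"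
    by (auto intro!: sum_nonneg simp: u)
  with N have N1: "real N > 1" unfolding B_def by linarith
  have NF: "(\<Sum>i\<in>I. \<bar>k i f\<bar>) < real N" if "f \<in> F" for f
    using member_le_sum[of f F "\<lambda>f. \<Sum>i\<in>I. \<bar>k i f\<bar>"] that \<open>finite F\<close> N nn
    unfolding B_def by (auto simp: sum_nonneg)
  have Nu: "1 / real N < u i" if "i \<in> I" "u i > 0" for i
  proof -
    have "1 / u i \<le> (\<Sum>i\<in>I. 1 / u i)"
      using member_le_sum[of i I "\<lambda>i. 1 / u i"] that \<open>finite I\<close> u by auto
    with N nn have "1 / u i < real N" unfolding B_def by linarith
    with that N1 show ?thesis by (simp add: field_simps)
  qed
  from N1 have "N > 0" by simp
  then obtain q p where q: "q > 0"
    and p: "\<And>i. i \<in> I \<Longrightarrow> \<bar>of_int q * u i - of_int (p i)\<bar> < 1 / real N"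
    using Dirichlet_approx_simult_finite[OF \<open>finite I\<close>] by blast
  have p0: "p i \<ge> 0" if "i \<in> I" for i
  proof -
    have "of_int q * u i \<ge> 0" using q u that by simp
    moreover have "1 / real N < 1" using N1 by simp
    ultimately have "real_of_int (p i) > -1" using p[OF that] by linarith
    thus ?thesis by linarith
  qed
  show thesis
  proof (rule that[where m = "\<lambda>i. nat (p i)"])
    fix i assume i: "i \<in> I" "u i > 0"
    have "u i \<le> of_int q * u i" using q i(2) by simp
    with p[OF i(1)] Nu[OF i] have "real_of_int (p i) > 0" by linarith
    thus "nat (p i) > 0" by simp
  next
    fix f assume f: "f \<in> F"
    have eq: "(\<Sum>i\<in>I. real (nat (p i)) * k i f) = (\<Sum>i\<in>I. of_int (p i) * k i f)"
      by (rule sum.cong) (auto simp: p0)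
    \<comment> \<open>Subtracting \<open>q\<close> times the real relation leaves only the
      approximation errors.\<close>
    have "(\<Sum>i\<in>I. of_int (p i) * k i f) = - (\<Sum>i\<in>I. (of_int q * u i - of_int (p i)) * k i f)"
      using rel[OF f] by (simp add: left_diff_distrib sum_subtractf mult.assoc flip: sum_distrib_left)
    also have "\<bar>\<dots>\<bar> \<le> (\<Sum>i\<in>I. \<bar>of_int q * u i - of_int (p i)\<bar> * \<bar>k i f\<bar>)"
      unfolding abs_minus_cancel abs_mult[symmetric] by (rule sum_abs)
    also have "\<dots> \<le> (\<Sum>i\<in>I. 1 / real N * \<bar>k i f\<bar>)"
      by (intro sum_mono mult_right_mono less_imp_le[OF p]) auto
    also have "\<dots> < 1"
      using NF[OF f] N1 by (simp add: field_simps flip: sum_divide_distrib)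
    finally have "\<bar>\<Sum>i\<in>I. of_int (p i) * k i f\<bar> < 1" .
    moreover have "(\<Sum>i\<in>I. of_int (p i) * k i f) \<in> \<int>"
      by (intro Ints_sum Ints_mult Ints_of_int int f)
    ultimately show "(\<Sum>i\<in>I. real (nat (p i)) * k i f) = 0"
      unfolding eq using Ints_nonzero_abs_less1 by blast
  qed
qed

lemma sum_mset_eq_sum_count:
  fixes M :: "'a::real_vector multiset"
  assumes "finite S" "set_mset M \<subseteq> S"
  shows "\<Sum>\<^sub># M = (\<Sum>x\<in>S. real (count M x) *\<^sub>R x)"
  using assms(2)
proof (induction M)
  case (add y M)
  have "(\<Sum>x\<in>S. real (count (add_mset y M) x) *\<^sub>R x)
      = (\<Sum>x\<in>S. real (count M x) *\<^sub>R x + (if x = y then y else 0))"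
    by (rule sum.cong) (auto simp: algebra_simps)
  also have "\<dots> = (\<Sum>x\<in>S. real (count M x) *\<^sub>R x) + y"
    using add.prems assms(1) by (simp add: sum.distrib sum.delta)
  finally show ?case using add by (simp add: add.commute)
qed simp

lemma count_sum_replicate_mset:
  assumes "finite S"
  shows "count (\<Sum>x\<in>S. replicate_mset (m x) x) y = (if y \<in> S then m y else 0)"
  using assms by (simp add: count_sum sum.delta' count_replicate_mset if_distrib cong: if_cong)

lemma multiset_with_multiplicities:
  fixes m :: "'a::real_vector \<Rightarrow> nat"
  assumes "finite S"
  obtains M where "set_mset M \<subseteq> S" and "\<And>x. x \<in> S \<Longrightarrow> count M x = m x"
    and "\<Sum>\<^sub># M = (\<Sum>x\<in>S. real (m x) *\<^sub>R x)"
proof -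
  define M where "M = (\<Sum>x\<in>S. replicate_mset (m x) x)"
  have count: "count M y = (if y \<in> S then m y else 0)" for y
    unfolding M_def by (rule count_sum_replicate_mset[OF assms])
  then have set: "set_mset M \<subseteq> S"
    by (metis count_eq_zero_iff subsetI)
  have "\<Sum>\<^sub># M = (\<Sum>x\<in>S. real (m x) *\<^sub>R x)"
    unfolding sum_mset_eq_sum_count[OF assms set] by (rule sum.cong) (auto simp: count)
  with set count that show thesis by simp
qed

text \<open>The nonnegative combinations of \<open>Z\<close> form a convex cone containing
  \<open>Z\<close>, so the hull lies inside them. The coefficients so obtained are what a Farkas
  certificate is made of.\<close>

lemma convex_cone_hull_finite_subset:
  fixes Z :: "'a::real_vector set"
  assumes "finite Z"
  shows "convex_cone hull Z \<subseteq> {\<Sum>z\<in>Z. u z *\<^sub>R z | u. \<forall>z\<in>Z. u z \<ge> 0}" (is "_ \<subseteq> ?K")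
proof (rule hull_minimal)
  show "Z \<subseteq> ?K"
  proof
    fix w assume "w \<in> Z"
    with assms have "(\<Sum>z\<in>Z. (if z = w then 1 else 0) *\<^sub>R z) = w"
      by (simp add: if_distrib[of "\<lambda>c. c *\<^sub>R _"] sum.delta cong: if_cong)
    then show "w \<in> ?K" by (intro CollectI exI[of _ "\<lambda>z. if z = w then 1 else 0"]) auto
  qed
  have 0: "0 \<in> ?K" by (intro CollectI exI[of _ "\<lambda>_. 0"]) auto
  have scale: "c *\<^sub>R x \<in> ?K" if x: "x \<in> ?K" and c: "c \<ge> 0" for c x
  proof -
    obtain u where "\<forall>z\<in>Z. u z \<ge> 0" "x = (\<Sum>z\<in>Z. u z *\<^sub>R z)" using x by auto
    with c show ?thesis
      by (intro CollectI exI[of _ "\<lambda>z. c * u z"]) (auto simp: scaleR_right.sum)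
  qed
  have add: "x + y \<in> ?K" if x: "x \<in> ?K" and y: "y \<in> ?K" for x y
  proof -
    obtain u u' where "\<forall>z\<in>Z. u z \<ge> 0" "x = (\<Sum>z\<in>Z. u z *\<^sub>R z)"
        "\<forall>z\<in>Z. u' z \<ge> 0" "y = (\<Sum>z\<in>Z. u' z *\<^sub>R z)" using x y by auto
    then show ?thesis
      by (intro CollectI exI[of _ "\<lambda>z. u z + u' z"]) (auto simp: sum.distrib scaleR_add_left)
  qed
  have "conic ?K" unfolding conic_def by (intro allI impI scale)
  moreover have "convex ?K" unfolding convex_def by (intro ballI allI impI add scale)
  ultimately show "convex_cone ?K" unfolding convex_cone_def using 0 by blast
qed

text \<open>A Farkas alternative whose infeasibility certificate is integral, because the vectors in \<open>Z\<close>
  have integral coordinates with respect to the functionals in \<open>F\<close>.\<close>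

lemma integral_Farkas:
  fixes Z F :: "'a::euclidean_space set"
  assumes Z: "finite Z" and F: "finite F" "\<And>x. (\<And>f. f \<in> F \<Longrightarrow> x \<bullet> f = 0) \<Longrightarrow> x = 0"
    and int: "\<And>z f. z \<in> Z \<Longrightarrow> f \<in> F \<Longrightarrow> z \<bullet> f \<in> \<int>"
    and w: "w \<in> Z"
  shows "(\<exists>y. (\<forall>z\<in>Z. y \<bullet> z \<ge> 0) \<and> y \<bullet> w > 0) \<or>
    (\<exists>M. set_mset M \<subseteq> Z \<and> w \<in># M \<and> \<Sum>\<^sub># M = 0)"
proof (cases "- w \<in> convex_cone hull Z")
  case True
  then obtain u where u: "\<forall>z\<in>Z. u z \<ge> 0" "- w = (\<Sum>z\<in>Z. u z *\<^sub>R z)"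
    using convex_cone_hull_finite_subset[OF Z] by blast
  \<comment> \<open>Moving \<open>- w\<close> to the other side gives \<open>w\<close> a coefficient
    of at least 1, so \<open>w\<close> is sure to occur in the integral certificate.\<close>
  define u' where "u' z = u z + (if z = w then 1 else 0)" for z
  have "(\<Sum>z\<in>Z. u' z *\<^sub>R z) = (\<Sum>z\<in>Z. u z *\<^sub>R z + (if z = w then w else 0))"
    by (rule sum.cong) (auto simp: u'_def algebra_simps)
  also have "\<dots> = 0"
    using Z w by (simp add: sum.distrib sum.delta flip: u(2))
  finally have sum0: "(\<Sum>z\<in>Z. u' z *\<^sub>R z) = 0" .
  have rel: "(\<Sum>z\<in>Z. u' z * (z \<bullet> f)) = 0" for f
    using arg_cong[OF sum0, of "\<lambda>x. x \<bullet> f"] by (simp add: inner_sum_left)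
  have "\<And>z. z \<in> Z \<Longrightarrow> u' z \<ge> 0" using u(1) by (auto simp: u'_def)
  from integral_relation_of_real_relation[where k = inner, OF Z F(1) int this rel]
  obtain m :: "'a \<Rightarrow> nat" where m: "\<And>i. i \<in> Z \<Longrightarrow> 0 < u' i \<Longrightarrow> 0 < m i"
      "\<And>f. f \<in> F \<Longrightarrow> (\<Sum>i\<in>Z. real (m i) * (i \<bullet> f)) = 0" by blast
  obtain M where M: "set_mset M \<subseteq> Z" "\<And>x. x \<in> Z \<Longrightarrow> count M x = m x"
      "\<Sum>\<^sub># M = (\<Sum>x\<in>Z. real (m x) *\<^sub>R x)"
    using multiset_with_multiplicities[OF Z] by blast
  have "\<Sum>\<^sub># M = 0"
    by (rule F(2)) (use m(2) in \<open>simp add: M(3) inner_sum_left\<close>)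
  moreover have "u' w > 0" using u(1) w by (auto simp: u'_def add_nonneg_pos)
  then have "w \<in># M"
    using m(1)[OF w] M(2)[OF w] by (simp flip: count_greater_zero_iff)
  ultimately show ?thesis using M(1) by blast
next
  case False
  from separating_hyperplane_closed_point[OF convex_convex_cone_hull closed_convex_cone_hull[OF Z] False]
  obtain a b where ab: "a \<bullet> (- w) < b" "\<And>x. x \<in> convex_cone hull Z \<Longrightarrow> a \<bullet> x > b"
    by blast
  have b: "b < 0" using ab(2)[OF convex_cone_hull_contains_0] by simp
  have "a \<bullet> z \<ge> 0" if "z \<in> Z" for z
  proof (rule ccontr)
    assume neg: "\<not> a \<bullet> z \<ge> 0"
    have "z \<in> convex_cone hull Z" by (simp add: hull_inc that)
    \<comment> \<open>Both \<open>b\<close> and \<open>a \<bullet> z\<close> are negative, so the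
      factor is positive; the rescaled point pairs with \<open>a\<close> to exactly
      \<open>b\<close>, against the strict separation.\<close>
    then have "(b / (a \<bullet> z)) *\<^sub>R z \<in> convex_cone hull Z"
      by (intro convex_cone_hull_mul) (use b neg in \<open>auto simp: divide_nonpos_neg\<close>)
    from ab(2)[OF this] neg show False by simp
  qed
  moreover have "a \<bullet> w > 0" using ab(1) b by simp
  ultimately show ?thesis by blast
qed

section \<open>Inner products of multiset sums\<close>

lemma inner_sum_mset_right: "a \<bullet> \<Sum>\<^sub># M = (\<Sum>x\<in>#M. a \<bullet> x)"
  by (induction M) (auto simp: inner_add_right)

lemma sum_mset_le_0:
  fixes f :: "'a \<Rightarrow> real"
  shows "(\<And>x. x \<in># M \<Longrightarrow> f x \<le> 0) \<Longrightarrow> (\<Sum>x\<in>#M. f x) \<le> 0"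
  by (induction M) (auto intro: add_nonpos_nonpos)

lemma exists_pos_of_sum_mset_pos:
  fixes f :: "'a \<Rightarrow> real"
  assumes "(\<Sum>x\<in>#M. f x) > 0"
  shows "\<exists>x\<in>#M. f x > 0"
proof (rule ccontr)
  assume "\<not> (\<exists>x\<in>#M. f x > 0)"
  then have "(\<Sum>x\<in>#M. f x) \<le> 0" by (intro sum_mset_le_0) (auto simp: not_less)
  with assms show False by simp
qed

text \<open>The common sum has positive inner product with itself; expanding both factors, some pair
  of summands must contribute positively.\<close>

lemma exists_pos_inner_of_sum_mset_eq:
  fixes A C :: "'a::euclidean_space multiset"
  assumes "\<Sum>\<^sub># A = \<Sum>\<^sub># C" "\<Sum>\<^sub># C \<noteq> 0"
  obtains a c where "a \<in># A" "c \<in># C" "c \<bullet> a > 0"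
proof -
  have "\<Sum>\<^sub># A \<bullet> \<Sum>\<^sub># C > 0"
    using assms by simp
  then obtain c where c: "c \<in># C" "\<Sum>\<^sub># A \<bullet> c > 0"
    unfolding inner_sum_mset_right[of "\<Sum>\<^sub># A"] using exists_pos_of_sum_mset_pos by blast
  then have "c \<bullet> \<Sum>\<^sub># A > 0" by (metis inner_commute)
  then obtain a where "a \<in># A" "c \<bullet> a > 0"
    unfolding inner_sum_mset_right[of c] using exists_pos_of_sum_mset_pos by blast
  with c that show thesis by blast
qed

section \<open>Reflections, hyperplanes and boundedness\<close>

lemma norm_reflection: "norm (reflection \<alpha> x) = norm x"
proof (cases "\<alpha> = 0")
  case False
  have "reflection \<alpha> x \<bullet> reflection \<alpha> x = x \<bullet> x"
    using False by (simp add: reflection_def inner_diff_left inner_diff_right inner_commute field_simps)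
  then show ?thesis by (simp add: norm_eq_sqrt_inner)
qed (simp add: reflection_def)

lemma reflection_uminus: "reflection (- \<alpha>) = reflection \<alpha>"
  by (simp add: reflection_def fun_eq_iff)

lemma reflection_add: "reflection \<alpha> (x + y) = reflection \<alpha> x + reflection \<alpha> y"
  by (simp add: reflection_def inner_add_left algebra_simps add_divide_distrib)

text \<open>The vectors whose inner products are bounded on \<open>R\<close> form a subspace. Once
  it is the whole space, the coordinates with respect to \<open>Basis\<close> are bounded.\<close>

lemma bounded_if_inner_spanning_bounded:
  fixes R :: "'a::euclidean_space set"
  assumes "span S = UNIV" and S: "\<And>s. s \<in> S \<Longrightarrow> \<exists>K. \<forall>x\<in>R. \<bar>x \<bullet> s\<bar> \<le> K"
  shows "bounded R"
proof -
  define T where "T = {b. \<exists>K. \<forall>x\<in>R. \<bar>x \<bullet> b\<bar> \<le> K}"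
  have "subspace T"
  proof (rule subspaceI)
    show "0 \<in> T" by (auto simp: T_def)
  next
    fix a b assume "a \<in> T" "b \<in> T"
    then obtain K L where KL: "\<And>x. x \<in> R \<Longrightarrow> \<bar>x \<bullet> a\<bar> \<le> K" "\<And>x. x \<in> R \<Longrightarrow> \<bar>x \<bullet> b\<bar> \<le> L"
      unfolding T_def by blast
    have "\<bar>x \<bullet> (a + b)\<bar> \<le> K + L" if "x \<in> R" for x
      using KL[OF that] by (simp add: inner_add_right)
    then show "a + b \<in> T" unfolding T_def by blast
  next
    fix c :: real and a assume "a \<in> T"
    then obtain K where K: "\<And>x. x \<in> R \<Longrightarrow> \<bar>x \<bullet> a\<bar> \<le> K" unfolding T_def by blast
    have "\<bar>x \<bullet> (c *\<^sub>R a)\<bar> \<le> \<bar>c\<bar> * K" if "x \<in> R" for x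
      using K[OF that] by (simp add: abs_mult mult_left_mono)
    then show "c *\<^sub>R a \<in> T" unfolding T_def by blast
  qed
  moreover have "S \<subseteq> T" using S by (auto simp: T_def)
  ultimately have "T = UNIV" using span_minimal[of S T] assms(1) by auto
  then have "\<exists>K. \<forall>x\<in>R. \<bar>x \<bullet> b\<bar> \<le> K" for b unfolding T_def by blast
  then obtain K where K: "\<And>x b. x \<in> R \<Longrightarrow> \<bar>x \<bullet> b\<bar> \<le> K b" by metis
  have "norm x \<le> (\<Sum>b\<in>Basis. K b)" if "x \<in> R" for x
    by (rule order_trans[OF norm_le_l1 sum_mono]) (rule K[OF that])
  then show ?thesis unfolding bounded_iff by blast
qed

lemma reflection_inner_root: "\<alpha> \<noteq> 0 \<Longrightarrow> reflection \<alpha> x \<bullet> \<alpha> = - (x \<bullet> \<alpha>)"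
  by (simp add: reflection_def inner_diff_left)

lemma connected_avoids_hyperplane:
  assumes "connected D" "D \<inter> root_hyperplane \<mu> k = {}" "x \<in> D" "y \<in> D"
  shows "x \<bullet> \<mu> > of_int k \<Longrightarrow> y \<bullet> \<mu> > of_int k" and "x \<bullet> \<mu> < of_int k \<Longrightarrow> y \<bullet> \<mu> < of_int k"
proof -
  have ne: "z \<bullet> \<mu> \<noteq> of_int k" if "z \<in> D" for z
    using assms(2) that by (auto simp: root_hyperplane_def)
  show "y \<bullet> \<mu> > of_int k" if "x \<bullet> \<mu> > of_int k"
  proof (rule ccontr)
    assume "\<not> y \<bullet> \<mu> > of_int k"
    then have "\<mu> \<bullet> y \<le> of_int k" "of_int k \<le> \<mu> \<bullet> x" using that by (simp_all add: inner_commute)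
    with connected_ivt_hyperplane[OF assms(1,4,3)] ne show False by (metis inner_commute)
  qed
  show "y \<bullet> \<mu> < of_int k" if "x \<bullet> \<mu> < of_int k"
  proof (rule ccontr)
    assume "\<not> y \<bullet> \<mu> < of_int k"
    then have "\<mu> \<bullet> x \<le> of_int k" "of_int k \<le> \<mu> \<bullet> y" using that by (simp_all add: inner_commute)
    with connected_ivt_hyperplane[OF assms(1,3,4)] ne show False by (metis inner_commute)
  qed
qed

text \<open>The arrangement mentions only roots of minimal and of maximal length. With two lengths
  every root is of one of these kinds, so every wall of the chamber belongs to the
  arrangement.\<close>

lemma roots_short_or_long:
  assumes "two_root_lengths \<Delta>" "\<alpha> \<in> \<Delta>"
  shows "\<alpha> \<in> short_roots \<Delta> \<or> \<alpha> \<in> long_roots \<Delta>"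
proof -
  obtain a b where ab: "norm ` \<Delta> = {a, b}"
    using assms(1) by (auto simp: two_root_lengths_def card_2_iff)
  then have len: "norm \<beta> \<in> {a, b}" if "\<beta> \<in> \<Delta>" for \<beta>
    using that by (metis imageI)
  show ?thesis
  proof (cases "norm \<alpha> = min a b")
    case True
    then have "norm \<alpha> \<le> norm \<beta>" if "\<beta> \<in> \<Delta>" for \<beta>
      using len[OF that] by auto
    with assms(2) show ?thesis by (simp add: short_roots_def)
  next
    case False
    with len[OF assms(2)] have "norm \<alpha> = max a b" by (auto simp: min_def max_def split: if_splits)
    then have "norm \<beta> \<le> norm \<alpha>" if "\<beta> \<in> \<Delta>" for \<beta>
      using len[OF that] by auto
    with assms(2) show ?thesis by (simp add: long_roots_def)
  qed
qed

section \<open>Positive roots and relations between them\<close>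

text \<open>The regular vector \<open>v\<close> is kept as a parameter: its inner product is a
  height, strictly positive on \<open>P\<close>, that drives the inductions and the choice of
  minimal elements.\<close>

locale positive_roots =
  fixes \<Delta> P :: "'a::euclidean_space set" and v :: 'a
  assumes root_system: "root_system \<Delta>"
    and crystallographic: "crystallographic \<Delta>"
    and regular: "\<And>\<alpha>. \<alpha> \<in> \<Delta> \<Longrightarrow> v \<bullet> \<alpha> \<noteq> 0"
    and P_eq: "P = {\<alpha>\<in>\<Delta>. v \<bullet> \<alpha> > 0}"
begin

lemma finite_roots: "finite \<Delta>" and zero_not_root: "0 \<notin> \<Delta>" and span_roots: "span \<Delta> = UNIV"
  using root_system by (auto simp: root_system_def)

lemma reflection_root: "\<alpha> \<in> \<Delta> \<Longrightarrow> \<beta> \<in> \<Delta> \<Longrightarrow> reflection \<alpha> \<beta> \<in> \<Delta>"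
  using root_system unfolding root_system_def by blast

lemma uminus_root:
  assumes "\<alpha> \<in> \<Delta>"
  shows "- \<alpha> \<in> \<Delta>"
proof -
  have "\<alpha> \<noteq> 0" using assms zero_not_root by auto
  then have "reflection \<alpha> \<alpha> = - \<alpha>" by (simp add: reflection_def scaleR_2)
  with reflection_root[OF assms assms] show ?thesis by simp
qed

lemma pos_root: "\<alpha> \<in> P \<Longrightarrow> \<alpha> \<in> \<Delta>" and pos_height: "\<alpha> \<in> P \<Longrightarrow> v \<bullet> \<alpha> > 0"
  by (auto simp: P_eq)

lemma finite_pos: "finite P"
  using finite_roots by (simp add: P_eq)

lemma root_pos_cases:
  assumes "\<alpha> \<in> \<Delta>"
  shows "\<alpha> \<in> P \<or> - \<alpha> \<in> P"
  using regular[OF assms] uminus_root[OF assms] assms by (auto simp: P_eq)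

text \<open>Coroots are the functionals to which the integral Farkas alternative is applied: they
  separate points because the roots span, and they take integral values on roots.\<close>

lemma zero_if_orthogonal_to_coroots:
  assumes "\<And>\<alpha>. \<alpha> \<in> \<Delta> \<Longrightarrow> x \<bullet> ((2 / (\<alpha> \<bullet> \<alpha>)) *\<^sub>R \<alpha>) = 0"
  shows "x = 0"
proof -
  have "orthogonal x \<alpha>" if "\<alpha> \<in> \<Delta>" for \<alpha>
    using assms[OF that] that zero_not_root by (auto simp: orthogonal_def)
  then have "orthogonal x x" using orthogonal_to_span[of x \<Delta> x] span_roots by (simp add: orthogonal_commute)
  then show ?thesis by (simp add: orthogonal_def)
qed

lemma coroot_integral:
  assumes "\<alpha> \<in> \<Delta>" "\<beta> \<in> \<Delta>"
  shows "\<beta> \<bullet> ((2 / (\<alpha> \<bullet> \<alpha>)) *\<^sub>R \<alpha>) \<in> \<int>"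
  using crystallographic assms by (auto simp: crystallographic_def)

section \<open>Reflections of short roots\<close>

lemma short_root: "\<gamma> \<in> short_roots \<Delta> \<Longrightarrow> \<gamma> \<in> \<Delta>"
  by (simp add: short_roots_def)

lemma reflection_short: "\<beta> \<in> \<Delta> \<Longrightarrow> \<gamma> \<in> short_roots \<Delta> \<Longrightarrow> reflection \<beta> \<gamma> \<in> short_roots \<Delta>"
  by (simp add: short_roots_def norm_reflection reflection_root)

lemma uminus_short: "\<gamma> \<in> short_roots \<Delta> \<Longrightarrow> - \<gamma> \<in> short_roots \<Delta>"
  by (simp add: short_roots_def uminus_root)

text \<open>The coefficient in the reflection is a positive integer \<open>n\<close>. If it were at
  least 2, then \<beta> \<bullet> \<beta> \<le> \<gamma> \<bullet> \<beta>, and since \<gamma> is no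
  longer than \<beta> the squared norm of \<gamma> - \<beta> would be at most 0.\<close>

lemma reflection_short_eq_diff:
  assumes \<gamma>: "\<gamma> \<in> short_roots \<Delta>" and \<beta>: "\<beta> \<in> \<Delta>" and pos: "\<gamma> \<bullet> \<beta> > 0" and ne: "\<gamma> \<noteq> \<beta>"
  shows "reflection \<beta> \<gamma> = \<gamma> - \<beta>"
proof -
  obtain n :: int where n: "2 * (\<gamma> \<bullet> \<beta>) / (\<beta> \<bullet> \<beta>) = of_int n"
    using crystallographic \<beta> short_root[OF \<gamma>] by (auto simp: crystallographic_def elim!: Ints_cases)
  have \<beta>0: "\<beta> \<bullet> \<beta> > 0" using \<beta> zero_not_root by auto
  with pos n have "real_of_int n > 0" by (metis divide_pos_pos mult_pos_pos zero_less_numeral)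
  moreover have "n < 2"
  proof (rule ccontr)
    assume "\<not> n < 2"
    then have "2 \<le> 2 * (\<gamma> \<bullet> \<beta>) / (\<beta> \<bullet> \<beta>)" unfolding n by simp
    with \<beta>0 have "\<beta> \<bullet> \<beta> \<le> \<gamma> \<bullet> \<beta>" by (simp add: field_simps)
    moreover have "\<gamma> \<bullet> \<gamma> \<le> \<beta> \<bullet> \<beta>"
      using \<gamma> \<beta> by (auto simp: short_roots_def norm_eq_sqrt_inner)
    ultimately have "(\<gamma> - \<beta>) \<bullet> (\<gamma> - \<beta>) \<le> 0"
      by (simp add: inner_diff_left inner_diff_right inner_commute)
    then have "\<gamma> - \<beta> = 0" by (metis inner_gt_zero_iff not_le)
    with ne show False by simp
  qed
  ultimately have "n = 1" by simp
  with n pos show ?thesis by (simp add: reflection_def)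
qed

lemma short_diff:
  assumes "\<gamma> \<in> short_roots \<Delta>" "\<beta> \<in> \<Delta>" "\<gamma> \<bullet> \<beta> > 0" "\<gamma> \<noteq> \<beta>"
  shows "\<gamma> - \<beta> \<in> short_roots \<Delta>"
  using reflection_short[OF assms(2,1)] reflection_short_eq_diff[OF assms] by simp

lemma reflection_short_eq_add:
  assumes "\<gamma> \<in> short_roots \<Delta>" "\<beta> \<in> \<Delta>" "\<gamma> \<bullet> \<beta> < 0" "\<gamma> \<noteq> - \<beta>"
  shows "reflection \<beta> \<gamma> = \<gamma> + \<beta>"
  using reflection_short_eq_diff[of \<gamma> "- \<beta>"] assms uminus_root
  by (simp add: reflection_uminus)

lemma height_sum_mset_pos:
  assumes "set_mset M \<subseteq> P" "M \<noteq> {#}"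
  shows "v \<bullet> \<Sum>\<^sub># M > 0"
  using assms
proof (induction M)
  case (add x M)
  then show ?case using pos_height[of x] by (cases "M = {#}") (auto simp: inner_add_right add_pos_pos)
qed simp

lemma sum_mset_pos_eq_0: "set_mset M \<subseteq> P \<Longrightarrow> \<Sum>\<^sub># M = 0 \<Longrightarrow> M = {#}"
  by (metis height_sum_mset_pos inner_zero_right less_irrefl)

section \<open>Simple roots and the root order\<close>

text \<open>Both summands of a decomposition have smaller height, so splitting terminates. The set
  \<open>Q\<close> is left general in order to cover \<open>P\<close> as well as
  \<open>pos_short \<Delta> P\<close>.\<close>

lemma sum_of_indecomposables:
  assumes "Q \<subseteq> P" "\<beta> \<in> Q"
  shows "\<exists>M. set_mset M \<subseteq> simple_roots Q \<and> \<beta> = \<Sum>\<^sub># M"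
  using assms(2)
\<comment> \<open>Heights are real numbers, so the induction counts the elements of smaller height
  instead.\<close>
proof (induction "card {\<gamma>\<in>Q. v \<bullet> \<gamma> < v \<bullet> \<beta>}" arbitrary: \<beta> rule: less_induct)
  case less
  have fin: "finite Q" using assms(1) finite_pos finite_subset by blast
  have smaller: "\<exists>M. set_mset M \<subseteq> simple_roots Q \<and> \<delta> = \<Sum>\<^sub># M"
    if "\<delta> \<in> Q" "v \<bullet> \<delta> < v \<bullet> \<beta>" for \<delta>
  proof (rule less.hyps)
    show "card {\<gamma>\<in>Q. v \<bullet> \<gamma> < v \<bullet> \<delta>} < card {\<gamma>\<in>Q. v \<bullet> \<gamma> < v \<bullet> \<beta>}"
      using fin that by (intro psubset_card_mono) auto
  qed (use that in auto)
  show ?case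
  proof (cases "\<beta> \<in> simple_roots Q")
    case True
    then show ?thesis by (intro exI[of _ "{#\<beta>#}"]) auto
  next
    case False
    with less.prems obtain \<gamma> \<delta> where "\<gamma> \<in> Q" "\<delta> \<in> Q" and \<beta>: "\<beta> = \<gamma> + \<delta>"
      by (auto simp: simple_roots_def)
    moreover from this assms(1) have "v \<bullet> \<gamma> > 0" "v \<bullet> \<delta> > 0"
      using pos_height by auto
    ultimately obtain M N where "set_mset M \<subseteq> simple_roots Q" "\<gamma> = \<Sum>\<^sub># M"
        "set_mset N \<subseteq> simple_roots Q" "\<delta> = \<Sum>\<^sub># N"
      using smaller[of \<gamma>] smaller[of \<delta>] by (auto simp: inner_add_right)
    with \<beta> show ?thesis by (intro exI[of _ "M + N"]) auto
  qed
qed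

lemma simple_pos: "simple_roots P \<subseteq> P"
  by (auto simp: simple_roots_def)

text \<open>Multisets of simple roots replace coefficient functions, so that simple roots can be
  removed one at a time.\<close>

lemma root_le_iff: "root_le P \<mu> \<gamma> \<longleftrightarrow> (\<exists>M. set_mset M \<subseteq> simple_roots P \<and> \<gamma> = \<mu> + \<Sum>\<^sub># M)"
proof
  have fin: "finite (simple_roots P)" using simple_pos finite_pos finite_subset by blast
  {
    assume "root_le P \<mu> \<gamma>"
    then obtain c where c: "\<gamma> - \<mu> = (\<Sum>\<alpha>\<in>simple_roots P. real (c \<alpha>) *\<^sub>R \<alpha>)"
      by (auto simp: root_le_def)
    obtain M where "set_mset M \<subseteq> simple_roots P" "\<Sum>\<^sub># M = (\<Sum>\<alpha>\<in>simple_roots P. real (c \<alpha>) *\<^sub>R \<alpha>)"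
      using multiset_with_multiplicities[OF fin] by blast
    with c show "\<exists>M. set_mset M \<subseteq> simple_roots P \<and> \<gamma> = \<mu> + \<Sum>\<^sub># M"
      by (intro exI[of _ M]) (auto simp: algebra_simps)
  }
  {
    assume "\<exists>M. set_mset M \<subseteq> simple_roots P \<and> \<gamma> = \<mu> + \<Sum>\<^sub># M"
    then obtain M where M: "set_mset M \<subseteq> simple_roots P" "\<gamma> = \<mu> + \<Sum>\<^sub># M"
      by blast
    show "root_le P \<mu> \<gamma>"
      unfolding root_le_def M(2) sum_mset_eq_sum_count[OF fin M(1)]
      by (intro exI[of _ "count M"]) simp
  }
qed

lemma root_le_refl: "root_le P \<mu> \<mu>"
  unfolding root_le_iff by (intro exI[of _ "{#}"]) simp

lemma root_le_trans: "root_le P \<kappa> \<mu> \<Longrightarrow> root_le P \<mu> \<nu> \<Longrightarrow> root_le P \<kappa> \<nu>"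
proof -
  assume "root_le P \<kappa> \<mu>" "root_le P \<mu> \<nu>"
  then obtain M N where "set_mset M \<subseteq> simple_roots P" "\<mu> = \<kappa> + \<Sum>\<^sub># M"
      "set_mset N \<subseteq> simple_roots P" "\<nu> = \<mu> + \<Sum>\<^sub># N"
    unfolding root_le_iff by blast
  then show ?thesis unfolding root_le_iff by (intro exI[of _ "M + N"]) (auto simp: add.assoc)
qed

lemma root_le_imp: "root_le P \<mu> \<nu> \<Longrightarrow> \<mu> = \<nu> \<or> v \<bullet> \<mu> < v \<bullet> \<nu>"
  unfolding root_le_iff
proof (elim exE conjE)
  fix M assume M: "set_mset M \<subseteq> simple_roots P" "\<nu> = \<mu> + \<Sum>\<^sub># M"
  then show ?thesis
    using height_sum_mset_pos[of M] simple_pos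
    by (cases "M = {#}") (auto simp: inner_add_right)
qed

lemma root_le_antisym: "root_le P \<mu> \<nu> \<Longrightarrow> root_le P \<nu> \<mu> \<Longrightarrow> \<mu> = \<nu>"
  by (drule root_le_imp)+ auto

lemma root_le_if_diff_pos: "\<gamma> - \<mu> \<in> P \<Longrightarrow> root_le P \<mu> \<gamma>"
proof -
  assume "\<gamma> - \<mu> \<in> P"
  then obtain M where "set_mset M \<subseteq> simple_roots P" "\<gamma> - \<mu> = \<Sum>\<^sub># M"
    using sum_of_indecomposables[OF order_refl] by blast
  then show ?thesis unfolding root_le_iff by (intro exI[of _ M]) (simp add: algebra_simps)
qed

lemma chamber_iff: "x \<in> chamber P \<longleftrightarrow> (\<forall>\<alpha>\<in>P. x \<bullet> \<alpha> > 0)"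
proof
  assume x: "x \<in> chamber P"
  have sum_pos: "set_mset M \<subseteq> simple_roots P \<Longrightarrow> M \<noteq> {#} \<Longrightarrow> x \<bullet> \<Sum>\<^sub># M > 0" for M
  proof (induction M)
    case (add y M)
    then show ?case using x
      by (cases "M = {#}") (auto simp: inner_add_right chamber_def intro!: add_pos_pos)
  qed simp
  show "\<forall>\<alpha>\<in>P. x \<bullet> \<alpha> > 0"
  proof
    fix \<alpha> assume \<alpha>: "\<alpha> \<in> P"
    then obtain M where M: "set_mset M \<subseteq> simple_roots P" "\<alpha> = \<Sum>\<^sub># M"
      using sum_of_indecomposables[of P] by blast
    moreover have "M \<noteq> {#}" using M(2) pos_height[OF \<alpha>] by auto
    ultimately show "x \<bullet> \<alpha> > 0" using sum_pos by blast
  qed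
qed (use simple_pos in \<open>auto simp: chamber_def\<close>)

lemma chamber_inner_mono:
  assumes "x \<in> chamber P" "root_le P \<mu> \<nu>"
  shows "x \<bullet> \<mu> \<le> x \<bullet> \<nu>"
proof -
  from assms(2) obtain M where M: "set_mset M \<subseteq> simple_roots P" "\<nu> = \<mu> + \<Sum>\<^sub># M"
    unfolding root_le_iff by blast
  have "set_mset M \<subseteq> simple_roots P \<Longrightarrow> x \<bullet> \<Sum>\<^sub># M \<ge> 0" for M
    using assms(1) by (induction M) (auto simp: inner_add_right chamber_def intro: add_nonneg_nonneg less_imp_le)
  with M show ?thesis by (simp add: inner_add_right)
qed

text \<open>The two sides of a relation have equal sums, so some summand on the left has positive inner
  product with some summand on the right, and such a pair can be cancelled down to at most one
  root.\<close>

lemma no_integral_relation: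
  assumes XP: "X \<subseteq> P"
    and XY: "\<And>\<mu> \<nu>. \<mu> \<in> X \<Longrightarrow> \<nu> \<in> Y \<Longrightarrow> \<mu> \<bullet> \<nu> > 0 \<Longrightarrow> \<mu> - \<nu> \<in> P"
    and YP: "\<And>\<nu> \<alpha>. \<nu> \<in> Y \<Longrightarrow> \<alpha> \<in> P \<Longrightarrow> \<nu> \<bullet> \<alpha> > 0 \<Longrightarrow> \<nu> = \<alpha> \<or> \<nu> - \<alpha> \<in> Y \<or> \<alpha> - \<nu> \<in> P"
    and "set_mset A \<subseteq> P" "set_mset B \<subseteq> X" "set_mset C \<subseteq> Y"
    and "\<Sum>\<^sub># A + \<Sum>\<^sub># B = \<Sum>\<^sub># C"
    and "(\<forall>\<mu>\<in>X. \<forall>\<nu>\<in>Y. \<mu> \<bullet> \<nu> \<le> 0) \<or> size C \<le> size B"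
  shows "B = {#}"
  using assms(4-)
\<comment> \<open>Weight 2 on \<open>C\<close> makes every cancellation decrease the measure: a root
  removed from \<open>C\<close> may add one root to \<open>A\<close>, while replacing \<nu> by \<nu>
  - \<alpha> keeps the size of \<open>C\<close> but shortens \<open>A\<close>.\<close>
proof (induction "2 * size C + size A" arbitrary: A B C rule: less_induct)
  case less
  show ?case
  proof (cases "\<Sum>\<^sub># C = 0")
    case True
    have "A + B = {#}"
      by (rule sum_mset_pos_eq_0) (use less.prems XP True in auto)
    then show ?thesis by simp
  next
    case False
    have "\<Sum>\<^sub># (A + B) = \<Sum>\<^sub># C" using less.prems by simp
    then obtain \<alpha> \<nu> where \<alpha>: "\<alpha> \<in># A + B" and \<nu>: "\<nu> \<in># C" and pos: "\<nu> \<bullet> \<alpha> > 0"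
      by (rule exists_pos_inner_of_sum_mset_eq[OF _ False])
    obtain C' where C: "C = add_mset \<nu> C'" using \<nu> by (metis insert_DiffM)
    have \<nu>Y: "\<nu> \<in> Y" using \<nu> less.prems by auto
    show ?thesis
    proof (cases "\<alpha> \<in># B")
      case True
      then obtain B' where B: "B = add_mset \<alpha> B'" by (metis insert_DiffM)
      have \<alpha>X: "\<alpha> \<in> X" using True less.prems by auto
      have \<delta>: "\<alpha> - \<nu> \<in> P" using XY[OF \<alpha>X \<nu>Y] pos by (simp add: inner_commute)
      have sz: "size C \<le> size B"
        using less.prems(5) \<alpha>X \<nu>Y pos by (metis inner_commute not_le)
      \<comment> \<open>If \<open>B'\<close> is empty, the size bound empties \<open>C'\<close> as
        well. Positive roots including \<alpha> - \<nu> would then sum to 0, so this case is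
        contradictory.\<close>
      have "B' = {#}"
      proof (rule less.hyps[of C' "add_mset (\<alpha> - \<nu>) A"])
        show "\<Sum>\<^sub># (add_mset (\<alpha> - \<nu>) A) + \<Sum>\<^sub># B' = \<Sum>\<^sub># C'"
          using less.prems(4) unfolding B C by (simp add: algebra_simps)
        show "(\<forall>\<mu>\<in>X. \<forall>\<nu>\<in>Y. \<mu> \<bullet> \<nu> \<le> 0) \<or> size C' \<le> size B'"
          using sz by (simp add: B C)
      qed (use less.prems(1-3) \<delta> in \<open>auto simp: B C\<close>)
      with sz have "C' = {#}" by (simp add: B C)
      with \<open>B' = {#}\<close> have "\<Sum>\<^sub># (add_mset (\<alpha> - \<nu>) A) = 0"
        using less.prems(4) unfolding B C by (simp add: algebra_simps)
      then have "add_mset (\<alpha> - \<nu>) A = {#}"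
        using less.prems(1) \<delta> by (intro sum_mset_pos_eq_0) auto
      then show ?thesis by simp
    next
      case False
      then have "\<alpha> \<in># A" using \<alpha> by simp
      then obtain A' where A: "A = add_mset \<alpha> A'" by (metis insert_DiffM)
      have "\<alpha> \<in> P" using A less.prems by auto
      from YP[OF \<nu>Y this pos] show ?thesis
      proof (elim disjE)
        assume "\<nu> = \<alpha>"
        show ?thesis
        proof (rule less.hyps[of C' A'])
          show "\<Sum>\<^sub># A' + \<Sum>\<^sub># B = \<Sum>\<^sub># C'"
            using less.prems(4) \<open>\<nu> = \<alpha>\<close> unfolding A C by (simp add: algebra_simps)
          show "(\<forall>\<mu>\<in>X. \<forall>\<nu>\<in>Y. \<mu> \<bullet> \<nu> \<le> 0) \<or> size C' \<le> size B"
            using less.prems(5) by (elim disj_forward) (simp_all add: C)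
        qed (use less.prems(1-3) in \<open>auto simp: A C\<close>)
      next
        assume *: "\<nu> - \<alpha> \<in> Y"
        show ?thesis
        proof (rule less.hyps[of "add_mset (\<nu> - \<alpha>) C'" A'])
          show "\<Sum>\<^sub># A' + \<Sum>\<^sub># B = \<Sum>\<^sub># (add_mset (\<nu> - \<alpha>) C')"
            using less.prems(4) unfolding A C by (simp add: algebra_simps)
          show "(\<forall>\<mu>\<in>X. \<forall>\<nu>\<in>Y. \<mu> \<bullet> \<nu> \<le> 0) \<or> size (add_mset (\<nu> - \<alpha>) C') \<le> size B"
            using less.prems(5) by (elim disj_forward) (simp_all add: C)
        qed (use less.prems(1-3) * in \<open>auto simp: A C\<close>)
      next
        assume *: "\<alpha> - \<nu> \<in> P"
        show ?thesis
        proof (rule less.hyps[of C' "add_mset (\<alpha> - \<nu>) A'"])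
          show "\<Sum>\<^sub># (add_mset (\<alpha> - \<nu>) A') + \<Sum>\<^sub># B = \<Sum>\<^sub># C'"
            using less.prems(4) unfolding A C by (simp add: algebra_simps)
          show "(\<forall>\<mu>\<in>X. \<forall>\<nu>\<in>Y. \<mu> \<bullet> \<nu> \<le> 0) \<or> size C' \<le> size B"
            using less.prems(5) by (elim disj_forward) (simp_all add: C)
        qed (use less.prems(1-3) * in \<open>auto simp: A C\<close>)
      qed
    qed
  qed
qed

text \<open>Here \<open>X\<close> will be the short part of the ideal and \<open>Y\<close> its
  complement among the short positive roots. A certificate of infeasibility would be a relation with
  \<open>size C \<le> size B\<close>; \<open>no_integral_relation\<close> empties \<open>B\<close>,
  and then everything else is empty too.\<close>

lemma exists_separating_point:
  assumes XP: "X \<subseteq> P" and finY: "finite Y"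
    and XY: "\<And>\<mu> \<nu>. \<mu> \<in> X \<Longrightarrow> \<nu> \<in> Y \<Longrightarrow> \<mu> \<bullet> \<nu> > 0 \<Longrightarrow> \<mu> - \<nu> \<in> P"
    and YP: "\<And>\<nu> \<alpha>. \<nu> \<in> Y \<Longrightarrow> \<alpha> \<in> P \<Longrightarrow> \<nu> \<bullet> \<alpha> > 0 \<Longrightarrow> \<nu> = \<alpha> \<or> \<nu> - \<alpha> \<in> Y \<or> \<alpha> - \<nu> \<in> P"
    and Y: "Y \<subseteq> P"
  shows "\<exists>x. (\<forall>\<alpha>\<in>P. x \<bullet> \<alpha> > 0) \<and> (\<forall>\<mu>\<in>X. x \<bullet> \<mu> > 1) \<and> (\<forall>\<nu>\<in>Y. x \<bullet> \<nu> < 1)"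
proof -
  \<comment> \<open>Homogenization: the point \<open>x / t\<close> is as required iff \<open>(x, t)\<close> is positive on \<open>Z\<close>.\<close>
  define Z where "Z = (\<lambda>\<alpha>. (\<alpha>, 0::real)) ` P \<union> (\<lambda>\<mu>. (\<mu>, -1)) ` X \<union> (\<lambda>\<nu>. (- \<nu>, 1)) ` Y \<union> {(0, 1)}"
  \<comment> \<open>The coroots detect the vector component and the extra functional detects the
    homogenizing coordinate; all of them are integral on \<open>Z\<close>.\<close>
  define F where "F = insert (0, 1::real) ((\<lambda>\<alpha>. ((2 / (\<alpha> \<bullet> \<alpha>)) *\<^sub>R \<alpha>, 0)) ` \<Delta>)"
  have Z: "finite Z" "(0, 1) \<in> Z"
    using finite_pos finY finite_subset[OF XP] by (auto simp: Z_def)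
  have F: "finite F" using finite_roots by (auto simp: F_def)
  have F0: "x = 0" if "\<And>f. f \<in> F \<Longrightarrow> x \<bullet> f = 0" for x
  proof -
    obtain y t where x: "x = (y, t)" by (cases x)
    have "t = 0" using that[of "(0, 1)"] by (auto simp: x F_def)
    moreover have "y = 0"
    proof (rule zero_if_orthogonal_to_coroots)
      fix \<alpha> assume "\<alpha> \<in> \<Delta>"
      then show "y \<bullet> ((2 / (\<alpha> \<bullet> \<alpha>)) *\<^sub>R \<alpha>) = 0"
        using that[of "((2 / (\<alpha> \<bullet> \<alpha>)) *\<^sub>R \<alpha>, 0)"] by (auto simp: x F_def)
    qed
    ultimately show ?thesis by (simp add: x zero_prod_def)
  qed
  \<comment> \<open>The number \<open>n\<close> counts copies of \<open>(0, 1)\<close>. The equation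
    for \<open>size M\<close> serves to show that \<open>M\<close> is empty once all its parts
    are.\<close>
  have split: "\<exists>A B C n. set_mset A \<subseteq> P \<and> set_mset B \<subseteq> X \<and> set_mset C \<subseteq> Y \<and>
      \<Sum>\<^sub># M = (\<Sum>\<^sub># A + \<Sum>\<^sub># B - \<Sum>\<^sub># C, real (size C) + real n - real (size B)) \<and>
      size M = size A + size B + size C + n" if "set_mset M \<subseteq> Z" for M
    using that
  proof (induction M)
    case empty
    show ?case
      by (rule exI[of _ "{#}"], rule exI[of _ "{#}"], rule exI[of _ "{#}"], rule exI[of _ 0])
        (simp add: zero_prod_def)
  next
    case (add z M)
    then obtain A B C n where *: "set_mset A \<subseteq> P" "set_mset B \<subseteq> X" "set_mset C \<subseteq> Y"
      "\<Sum>\<^sub># M = (\<Sum>\<^sub># A + \<Sum>\<^sub># B - \<Sum>\<^sub># C, real (size C) + real n - real (size B))"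
      "size M = size A + size B + size C + n" by auto
    have "z \<in> Z" using add.prems by simp
    then consider \<alpha> where "\<alpha> \<in> P" "z = (\<alpha>, 0)" | \<mu> where "\<mu> \<in> X" "z = (\<mu>, -1)"
      | \<nu> where "\<nu> \<in> Y" "z = (- \<nu>, 1)" | "z = (0, 1)"
      unfolding Z_def by blast
    then show ?case
    proof cases
      case 1
      with * show ?thesis
        by (intro exI[of _ "add_mset \<alpha> A"] exI[of _ B] exI[of _ C] exI[of _ n]) auto
    next
      case 2
      with * show ?thesis
        by (intro exI[of _ A] exI[of _ "add_mset \<mu> B"] exI[of _ C] exI[of _ n]) auto
    next
      case 3
      with * show ?thesis
        by (intro exI[of _ A] exI[of _ B] exI[of _ "add_mset \<nu> C"] exI[of _ n]) auto
    next
      case 4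
      with * show ?thesis
        by (intro exI[of _ A] exI[of _ B] exI[of _ C] exI[of _ "Suc n"]) auto
    qed
  qed
  have "\<exists>y. (\<forall>z\<in>Z. y \<bullet> z \<ge> 0) \<and> y \<bullet> w > 0" if w: "w \<in> Z" for w
  proof -
    have "z \<bullet> f \<in> \<int>" if "z \<in> Z" "f \<in> F" for z f
      using that coroot_integral pos_root XP Y unfolding Z_def F_def
      by (auto simp del: inner_scaleR_right)
    moreover have "\<not> (\<exists>M. set_mset M \<subseteq> Z \<and> w \<in># M \<and> \<Sum>\<^sub># M = 0)"
    proof
      assume "\<exists>M. set_mset M \<subseteq> Z \<and> w \<in># M \<and> \<Sum>\<^sub># M = 0"
      then obtain M where M: "set_mset M \<subseteq> Z" "w \<in># M" "\<Sum>\<^sub># M = 0" by blast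
      obtain A B C n where *: "set_mset A \<subseteq> P" "set_mset B \<subseteq> X" "set_mset C \<subseteq> Y"
        "\<Sum>\<^sub># M = (\<Sum>\<^sub># A + \<Sum>\<^sub># B - \<Sum>\<^sub># C, real (size C) + real n - real (size B))"
        "size M = size A + size B + size C + n" using split[OF M(1)] by blast
      have eq: "\<Sum>\<^sub># A + \<Sum>\<^sub># B = \<Sum>\<^sub># C" "size B = size C + n"
        using *(4) M(3) by (auto simp: zero_prod_def)
      then have B0: "B = {#}"
        using no_integral_relation[OF XP XY YP *(1-3)] by simp
      then have "C = {#}" "n = 0" using eq(2) by auto
      with eq(1) B0 have "A = {#}" using sum_mset_pos_eq_0[OF *(1)] by simp
      with \<open>C = {#}\<close> \<open>n = 0\<close> B0 *(5) M(2) show False by simp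
    qed
    ultimately show ?thesis using integral_Farkas[OF Z(1) F F0 _ w] by blast
  qed
  then obtain y where y: "\<And>w z. w \<in> Z \<Longrightarrow> z \<in> Z \<Longrightarrow> y w \<bullet> z \<ge> 0" "\<And>w. w \<in> Z \<Longrightarrow> y w \<bullet> w > 0"
    by metis
  \<comment> \<open>Each \<open>y w\<close> is nonnegative on \<open>Z\<close> and positive at
    \<open>w\<close>, so the sum is positive on all of \<open>Z\<close>. Positivity at
    \<open>(0, 1)\<close> allows dividing by \<open>t\<close>.\<close>
  define s where "s = (\<Sum>w\<in>Z. y w)"
  have s: "s \<bullet> z > 0" if "z \<in> Z" for z
    unfolding s_def inner_sum_left by (rule sum_pos2[OF Z(1) that]) (use y that in auto)
  obtain x t where xt: "s = (x, t)" by (cases s)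
  have t: "t > 0" using s[OF Z(2)] by (simp add: xt)
  have "x \<bullet> \<alpha> > 0" if "\<alpha> \<in> P" for \<alpha>
    using s[of "(\<alpha>, 0)"] that by (auto simp: xt Z_def)
  moreover have "x \<bullet> \<mu> > t" if "\<mu> \<in> X" for \<mu>
    using s[of "(\<mu>, -1)"] that by (auto simp: xt Z_def)
  moreover have "x \<bullet> \<nu> < t" if "\<nu> \<in> Y" for \<nu>
    using s[of "(- \<nu>, 1)"] that by (auto simp: xt Z_def)
  ultimately show ?thesis
    using t by (intro exI[of _ "(1 / t) *\<^sub>R x"]) (auto simp: field_simps)
qed

text \<open>The same method with the single root \<theta> in the role of \<open>X\<close>. No bound
  on sizes is available, so the sign condition on \<theta> \<bullet> \<nu> takes its place in
  \<open>no_integral_relation\<close>.\<close>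

lemma exists_recession_direction:
  assumes \<theta>: "\<theta> \<in> P" and Y: "Y \<subseteq> P"
    and \<theta>Y: "\<And>\<nu>. \<nu> \<in> Y \<Longrightarrow> \<theta> \<bullet> \<nu> \<le> 0"
    and YP: "\<And>\<nu> \<alpha>. \<nu> \<in> Y \<Longrightarrow> \<alpha> \<in> P \<Longrightarrow> \<nu> \<bullet> \<alpha> > 0 \<Longrightarrow> \<nu> = \<alpha> \<or> \<nu> - \<alpha> \<in> Y \<or> \<alpha> - \<nu> \<in> P"
  shows "\<exists>y. (\<forall>\<alpha>\<in>P. y \<bullet> \<alpha> \<ge> 0) \<and> (\<forall>\<nu>\<in>Y. y \<bullet> \<nu> \<le> 0) \<and> y \<bullet> \<theta> > 0"
proof -
  define Z where "Z = P \<union> uminus ` Y"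
  define F where "F = (\<lambda>\<alpha>. (2 / (\<alpha> \<bullet> \<alpha>)) *\<^sub>R \<alpha>) ` \<Delta>"
  have Z: "finite Z" "\<theta> \<in> Z"
    using finite_pos finite_subset[OF Y] \<theta> by (auto simp: Z_def)
  have F: "finite F" using finite_roots by (auto simp: F_def)
  have F0: "x = 0" if "\<And>f. f \<in> F \<Longrightarrow> x \<bullet> f = 0" for x
    by (rule zero_if_orthogonal_to_coroots) (rule that, simp add: F_def)
  have int: "z \<bullet> f \<in> \<int>" if "z \<in> Z" "f \<in> F" for z f
    using that coroot_integral pos_root Y uminus_root unfolding Z_def F_def
    by (auto simp del: inner_scaleR_right)
  \<comment> \<open>The last conjunct guarantees that \<theta> survives on the left-hand side of the
    relation.\<close>
  have split: "\<exists>A C. set_mset A \<subseteq> P \<and> set_mset C \<subseteq> Y \<and> \<Sum>\<^sub># M = \<Sum>\<^sub># A - \<Sum>\<^sub># C \<and>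
      (\<forall>\<alpha>\<in>P. \<alpha> \<in># M \<longrightarrow> \<alpha> \<in># A)" if "set_mset M \<subseteq> Z" for M
    using that
  proof (induction M)
    case empty
    show ?case by (rule exI[of _ "{#}"], rule exI[of _ "{#}"]) simp
  next
    case (add z M)
    then obtain A C where *: "set_mset A \<subseteq> P" "set_mset C \<subseteq> Y" "\<Sum>\<^sub># M = \<Sum>\<^sub># A - \<Sum>\<^sub># C"
      "\<forall>\<alpha>\<in>P. \<alpha> \<in># M \<longrightarrow> \<alpha> \<in># A" by auto
    show ?case
    proof (cases "z \<in> P")
      case True
      with * show ?thesis by (intro exI[of _ "add_mset z A"] exI[of _ C]) auto
    next
      case False
      then obtain \<nu> where "\<nu> \<in> Y" "z = - \<nu>" using add.prems by (auto simp: Z_def)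
      with * False show ?thesis by (intro exI[of _ A] exI[of _ "add_mset \<nu> C"]) auto
    qed
  qed
  have "\<not> (\<exists>M. set_mset M \<subseteq> Z \<and> \<theta> \<in># M \<and> \<Sum>\<^sub># M = 0)"
  proof
    assume "\<exists>M. set_mset M \<subseteq> Z \<and> \<theta> \<in># M \<and> \<Sum>\<^sub># M = 0"
    then obtain A C where *: "set_mset A \<subseteq> P" "set_mset C \<subseteq> Y" "\<Sum>\<^sub># A = \<Sum>\<^sub># C" "\<theta> \<in># A"
      using split \<theta> by (metis eq_iff_diff_eq_0)
    obtain A' where A: "A = add_mset \<theta> A'" using *(4) by (metis insert_DiffM)
    have "{#\<theta>#} = {#}"
    proof (rule no_integral_relation[of "{\<theta>}" Y A' "{#\<theta>#}" C])
      show "\<mu> - \<nu> \<in> P" if "\<mu> \<in> {\<theta>}" "\<nu> \<in> Y" "\<mu> \<bullet> \<nu> > 0" for \<mu> \<nu>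
        using that \<theta>Y[of \<nu>] by simp
      show "(\<forall>\<mu>\<in>{\<theta>}. \<forall>\<nu>\<in>Y. \<mu> \<bullet> \<nu> \<le> 0) \<or> size C \<le> size {#\<theta>#}"
        using \<theta>Y by simp
      show "\<nu> = \<alpha> \<or> \<nu> - \<alpha> \<in> Y \<or> \<alpha> - \<nu> \<in> P"
        if "\<nu> \<in> Y" "\<alpha> \<in> P" "\<nu> \<bullet> \<alpha> > 0" for \<nu> \<alpha>
        using YP that .
    qed (use * \<theta> in \<open>simp_all add: A add.commute\<close>)
    then show False by simp
  qed
  then obtain y where "\<forall>z\<in>Z. y \<bullet> z \<ge> 0" "y \<bullet> \<theta> > 0"
    using integral_Farkas[OF Z(1) F F0 int Z(2)] by blast
  moreover have "y \<bullet> \<nu> \<le> 0" if "\<nu> \<in> Y" for \<nu>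
    using calculation(1) that by (force simp: Z_def)
  ultimately show ?thesis by (intro exI[of _ y]) (auto simp: Z_def)
qed

section \<open>Short roots and regions\<close>

text \<open>If a root \<beta> is not orthogonal to a short root \<delta>, then \<beta> is a multiple
  of the difference of \<delta> and its short mirror image, hence lies in the span. Roots outside
  the span are therefore orthogonal to those inside, and irreducibility leaves none outside.\<close>

lemma span_short_roots:
  assumes "irreducible_roots \<Delta>"
  shows "span (short_roots \<Delta>) = UNIV"
proof -
  let ?U = "span (short_roots \<Delta>)"
  have "\<Delta> \<noteq> {}" using assms by (simp add: irreducible_roots_def)
  then obtain \<gamma> where "\<gamma> \<in> \<Delta>" "\<And>\<beta>. \<beta> \<in> \<Delta> \<Longrightarrow> norm \<gamma> \<le> norm \<beta>"
    using finite_roots by (metis arg_min_if_finite(1) arg_min_least)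
  then have \<gamma>: "\<gamma> \<in> \<Delta> \<inter> ?U" by (auto simp: short_roots_def intro!: span_base)
  have orth: "\<alpha> \<bullet> \<beta> = 0" if \<beta>: "\<beta> \<in> \<Delta> - ?U" and \<alpha>: "\<alpha> \<in> ?U" for \<alpha> \<beta>
  proof -
    have "orthogonal \<beta> \<delta>" if \<delta>: "\<delta> \<in> short_roots \<Delta>" for \<delta>
    proof (rule ccontr)
      assume no: "\<not> orthogonal \<beta> \<delta>"
      define c where "c = 2 * (\<delta> \<bullet> \<beta>) / (\<beta> \<bullet> \<beta>)"
      have "\<beta> \<noteq> 0" using \<beta> span_zero by blast
      with no have "c \<noteq> 0" by (auto simp: c_def orthogonal_def inner_commute)
      have "\<beta> \<in> \<Delta>" using \<beta> by simp
      then have "reflection \<beta> \<delta> \<in> ?U" by (intro span_base reflection_short[OF _ \<delta>])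
      then have "\<delta> - reflection \<beta> \<delta> \<in> ?U" by (rule span_diff[OF span_base[OF \<delta>]])
      then have "c *\<^sub>R \<beta> \<in> ?U" by (simp add: reflection_def c_def)
      from span_mul[OF this, of "inverse c"] \<open>c \<noteq> 0\<close> have "\<beta> \<in> ?U" by simp
      with \<beta> show False by simp
    qed
    then have "orthogonal \<beta> \<alpha>" using orthogonal_to_span[OF \<alpha>, of \<beta>] by blast
    then show ?thesis by (simp add: orthogonal_def inner_commute)
  qed
  have "\<Delta> - ?U = {}"
  proof (rule ccontr)
    assume "\<Delta> - ?U \<noteq> {}"
    then have "\<exists>A B. A \<noteq> {} \<and> B \<noteq> {} \<and> A \<inter> B = {} \<and> A \<union> B = \<Delta> \<and> (\<forall>\<alpha>\<in>A. \<forall>\<beta>\<in>B. \<alpha> \<bullet> \<beta> = 0)"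
      by - (rule exI[of _ "\<Delta> \<inter> ?U"], rule exI[of _ "\<Delta> - ?U"], use \<gamma> orth in auto)
    with conjunct2[OF assms[unfolded irreducible_roots_def]] show False by contradiction
  qed
  then have "span \<Delta> \<subseteq> ?U" by (intro span_minimal) auto
  with span_roots show ?thesis by auto
qed

lemma pos_short_cases:
  assumes "\<gamma> \<in> short_roots \<Delta>"
  shows "\<gamma> \<in> pos_short \<Delta> P \<or> - \<gamma> \<in> pos_short \<Delta> P"
  using root_pos_cases[OF short_root[OF assms]] uminus_short[OF assms] assms
  by (auto simp: pos_short_def)

lemma pos_short_diff:
  assumes "\<gamma> \<in> pos_short \<Delta> P" "\<alpha> \<in> P" "\<gamma> \<bullet> \<alpha> > 0" "\<gamma> \<noteq> \<alpha>"
  shows "\<gamma> - \<alpha> \<in> pos_short \<Delta> P \<or> \<alpha> - \<gamma> \<in> pos_short \<Delta> P"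
  using pos_short_cases[OF short_diff[of \<gamma> \<alpha>]] assms pos_root by (simp add: pos_short_def)

lemma span_pos_short_simple:
  assumes "irreducible_roots \<Delta>"
  shows "span (simple_roots (pos_short \<Delta> P)) = UNIV"
proof -
  let ?T = "span (simple_roots (pos_short \<Delta> P))"
  have mset: "set_mset M \<subseteq> simple_roots (pos_short \<Delta> P) \<Longrightarrow> \<Sum>\<^sub># M \<in> ?T" for M
    by (induction M) (auto intro: span_zero span_add span_base)
  have pos: "\<gamma> \<in> ?T" if "\<gamma> \<in> pos_short \<Delta> P" for \<gamma>
    using sum_of_indecomposables[OF _ that] mset by (auto simp: pos_short_def)
  have "short_roots \<Delta> \<subseteq> ?T"
  proof
    fix \<gamma> assume "\<gamma> \<in> short_roots \<Delta>"
    then have "\<gamma> \<in> ?T \<or> - \<gamma> \<in> ?T" using pos_short_cases pos by blast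
    then show "\<gamma> \<in> ?T" using span_neg[of "- \<gamma>"] by auto
  qed
  then have "span (short_roots \<Delta>) \<subseteq> ?T" by (intro span_minimal) auto
  with span_short_roots[OF assms] show ?thesis by auto
qed

section \<open>Ideals and dominant regions\<close>

lemma mem_upper_ideal_self: "\<gamma> \<in> \<Gamma> \<Longrightarrow> \<gamma> \<in> P \<Longrightarrow> \<gamma> \<in> upper_ideal P \<Gamma>"
  using root_le_refl by (auto simp: upper_ideal_def)

lemma upper_ideal_upward: "\<mu> \<in> upper_ideal P \<Gamma> \<Longrightarrow> \<nu> \<in> P \<Longrightarrow> root_le P \<mu> \<nu> \<Longrightarrow> \<nu> \<in> upper_ideal P \<Gamma>"
  unfolding upper_ideal_def using root_le_trans by blast

text \<open>The difference is a short root up to sign. Were \<nu> - \<mu> positive, \<nu> would lie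
  above \<mu> and so in the ideal.\<close>

lemma pos_short_ideal_diff:
  assumes "\<mu> \<in> upper_ideal P \<Gamma> \<inter> pos_short \<Delta> P" "\<nu> \<in> pos_short \<Delta> P - upper_ideal P \<Gamma>" "\<mu> \<bullet> \<nu> > 0"
  shows "\<mu> - \<nu> \<in> pos_short \<Delta> P"
proof -
  have "\<nu> - \<mu> \<notin> P"
    using root_le_if_diff_pos upper_ideal_upward assms by (auto simp: pos_short_def)
  moreover have "\<mu> \<noteq> \<nu>" using assms by auto
  ultimately show ?thesis using pos_short_diff[of \<mu> \<nu>] assms by (auto simp: pos_short_def)
qed

text \<open>Complements of ideals are closed downwards, so subtracting a positive root cannot lead
  into the ideal.\<close>

lemma pos_short_below_ideal_diff:
  assumes "\<nu> \<in> pos_short \<Delta> P - upper_ideal P \<Gamma>" "\<alpha> \<in> P" "\<nu> \<bullet> \<alpha> > 0"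
  shows "\<nu> = \<alpha> \<or> \<nu> - \<alpha> \<in> pos_short \<Delta> P - upper_ideal P \<Gamma> \<or> \<alpha> - \<nu> \<in> P"
proof -
  have "root_le P (\<nu> - \<alpha>) \<nu>" by (rule root_le_if_diff_pos) (simp add: assms)
  then have "\<nu> - \<alpha> \<notin> upper_ideal P \<Gamma>"
    using upper_ideal_upward assms by (auto simp: pos_short_def)
  then show ?thesis using pos_short_diff[of \<nu> \<alpha>] assms by (auto simp: pos_short_def)
qed

lemma s_region_nonempty: "s_region \<Delta> P \<Gamma> \<noteq> {}"
proof -
  let ?X = "upper_ideal P \<Gamma> \<inter> pos_short \<Delta> P" and ?Y = "pos_short \<Delta> P - upper_ideal P \<Gamma>"
  have sub: "?X \<subseteq> P" "?Y \<subseteq> P" by (auto simp: pos_short_def)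
  have XY: "\<mu> - \<nu> \<in> P" if "\<mu> \<in> ?X" "\<nu> \<in> ?Y" "\<mu> \<bullet> \<nu> > 0" for \<mu> \<nu>
    using pos_short_ideal_diff[OF that] by (simp add: pos_short_def)
  from exists_separating_point[OF sub(1) finite_subset[OF sub(2) finite_pos] XY
      pos_short_below_ideal_diff sub(2)]
  show ?thesis unfolding s_region_def chamber_iff by blast
qed

lemma convex_s_region: "convex (s_region \<Delta> P \<Gamma>)"
proof -
  have "s_region \<Delta> P \<Gamma> = (\<Inter>\<alpha>\<in>simple_roots P. {x. \<alpha> \<bullet> x > 0}) \<inter>
      (\<Inter>\<mu>\<in>upper_ideal P \<Gamma> \<inter> pos_short \<Delta> P. {x. \<mu> \<bullet> x > 1}) \<inter>
      (\<Inter>\<mu>\<in>pos_short \<Delta> P - upper_ideal P \<Gamma>. {x. \<mu> \<bullet> x < 1})"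
    by (auto simp: s_region_def chamber_def inner_commute)
  then show ?thesis
    by (simp add: convex_Int convex_INT convex_halfspace_gt convex_halfspace_lt)
qed

text \<open>The region is convex and misses the arrangement. It is maximal because a connected set
  missing the hyperplanes cannot change sides, and its defining inequalities, rewritten over all
  positive roots, involve only hyperplanes of the arrangement.\<close>

lemma s_region_in_dominant_regions:
  assumes "two_root_lengths \<Delta>"
  shows "s_region \<Delta> P \<Gamma> \<in> dominant_regions \<Delta> P"
proof -
  let ?R = "s_region \<Delta> P \<Gamma>" and ?U = "UNIV - \<Union>(semi_Catalan \<Delta> P)"
  have long: "\<alpha> \<in> pos_short \<Delta> P \<or> \<alpha> \<in> pos_long \<Delta> P" if "\<alpha> \<in> P" for \<alpha>
    using roots_short_or_long[OF assms pos_root[OF that]] that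
    by (auto simp: pos_short_def pos_long_def)
  have H0: "root_hyperplane \<alpha> 0 \<in> semi_Catalan \<Delta> P" if "\<alpha> \<in> P" for \<alpha>
    using long[OF that] unfolding semi_Catalan_def by blast
  have H1: "root_hyperplane \<mu> 1 \<in> semi_Catalan \<Delta> P" if "\<mu> \<in> pos_short \<Delta> P" for \<mu>
    using that unfolding semi_Catalan_def by blast
  have sub: "?R \<subseteq> ?U"
  proof
    fix x assume x: "x \<in> ?R"
    have pos: "x \<bullet> \<alpha> > 0" if "\<alpha> \<in> P" for \<alpha>
      using x that by (simp add: s_region_def chamber_iff)
    have "x \<bullet> \<mu> > 1 \<or> x \<bullet> \<mu> < 1" if "\<mu> \<in> pos_short \<Delta> P" for \<mu>
      using x that unfolding s_region_def by blast
    \<comment> \<open>Positivity on \<open>P\<close> disposes of the levels -1 and 0; only level 1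
      needs the strict inequalities of the region.\<close>
    with pos have "x \<notin> root_hyperplane \<mu> k" if "\<mu> \<in> pos_short \<Delta> P" "k \<in> {-1, 0, 1}" for \<mu> k
      using that by (force simp: root_hyperplane_def pos_short_def)
    moreover have "x \<notin> root_hyperplane \<nu> 0" if "\<nu> \<in> pos_long \<Delta> P" for \<nu>
      using pos[of \<nu>] that by (auto simp: root_hyperplane_def pos_long_def)
    ultimately show "x \<in> ?U" unfolding semi_Catalan_def by blast
  qed
  have max: "D = ?R" if D: "?R \<subseteq> D" "D \<subseteq> ?U" "connected D" for D
  proof
    obtain x where x: "x \<in> ?R" "x \<in> D" using s_region_nonempty D(1) by blast
    show "D \<subseteq> ?R"
    proof
      fix y assume y: "y \<in> D"
      note side = connected_avoids_hyperplane[OF D(3) _ x(2) y]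
      have disj: "D \<inter> H = {}" if "H \<in> semi_Catalan \<Delta> P" for H using D(2) that by blast
      have "y \<in> chamber P"
        using side(1)[OF disj[OF H0]] x(1) by (auto simp: s_region_def chamber_iff)
      moreover have "y \<bullet> \<mu> > 1" if "\<mu> \<in> upper_ideal P \<Gamma> \<inter> pos_short \<Delta> P" for \<mu>
        using side(1)[OF disj[OF H1]] x(1) that by (simp add: s_region_def)
      moreover have "y \<bullet> \<mu> < 1" if "\<mu> \<in> pos_short \<Delta> P - upper_ideal P \<Gamma>" for \<mu>
        using side(2)[OF disj[OF H1]] x(1) that by (simp add: s_region_def)
      ultimately show "y \<in> ?R" by (simp add: s_region_def)
    qed
  qed (use D in simp)
  have "?R \<in> components ?U"
    unfolding in_components_maximal
    using s_region_nonempty sub convex_connected[OF convex_s_region] max by blast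
  then show ?thesis by (auto simp: dominant_regions_def arrangement_regions_def s_region_def)
qed

text \<open>A common point shows which short roots lie in either ideal. Then \<gamma> in one
  antichain lies above some \<delta> in the other, which lies above some \<epsilon> in the first;
  the antichain property and antisymmetry make all three equal.\<close>

lemma inj_on_s_region: "inj_on (s_region \<Delta> P) {\<Gamma>. short_antichain \<Delta> P \<Gamma>}"
proof (rule inj_onI)
  have sub: "\<Gamma> \<subseteq> \<Gamma>'" if \<Gamma>: "short_antichain \<Delta> P \<Gamma>" and \<Gamma>': "short_antichain \<Delta> P \<Gamma>'"
    and eq: "s_region \<Delta> P \<Gamma> = s_region \<Delta> P \<Gamma>'" for \<Gamma> \<Gamma>'
  proof
    obtain x where x: "x \<in> s_region \<Delta> P \<Gamma>" "x \<in> s_region \<Delta> P \<Gamma>'"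
      using s_region_nonempty eq by blast
    have ideal: "\<mu> \<in> upper_ideal P \<Gamma> \<longleftrightarrow> \<mu> \<in> upper_ideal P \<Gamma>'" if "\<mu> \<in> pos_short \<Delta> P" for \<mu>
    proof -
      have "z \<bullet> \<mu> > 1 \<longleftrightarrow> \<mu> \<in> upper_ideal P \<Theta>" if "z \<in> s_region \<Delta> P \<Theta>" for z \<Theta>
        using that \<open>\<mu> \<in> pos_short \<Delta> P\<close>
        by (cases "\<mu> \<in> upper_ideal P \<Theta>") (auto simp: s_region_def not_less intro: less_imp_le)
      with x show ?thesis by blast
    qed
    have short: "\<gamma> \<in> P \<and> \<gamma> \<in> pos_short \<Delta> P" if "\<gamma> \<in> \<Gamma> \<union> \<Gamma>'" for \<gamma>
      using \<Gamma> \<Gamma>' that by (auto simp: short_antichain_def root_antichain_def pos_short_def)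
    fix \<gamma> assume \<gamma>: "\<gamma> \<in> \<Gamma>"
    then have "\<gamma> \<in> upper_ideal P \<Gamma>'" using ideal mem_upper_ideal_self short by blast
    then obtain \<delta> where \<delta>: "\<delta> \<in> \<Gamma>'" "root_le P \<delta> \<gamma>" by (auto simp: upper_ideal_def)
    then have "\<delta> \<in> upper_ideal P \<Gamma>" using ideal mem_upper_ideal_self short by blast
    then obtain \<epsilon> where \<epsilon>: "\<epsilon> \<in> \<Gamma>" "root_le P \<epsilon> \<delta>" by (auto simp: upper_ideal_def)
    have "\<epsilon> = \<gamma>"
      using \<Gamma> \<gamma> \<epsilon>(1) root_le_trans[OF \<epsilon>(2) \<delta>(2)]
      by (auto simp: short_antichain_def root_antichain_def)
    with \<epsilon>(2) \<delta> root_le_antisym show "\<gamma> \<in> \<Gamma>'" by blast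
  qed
  fix \<Gamma> \<Gamma>' assume "\<Gamma> \<in> {\<Gamma>. short_antichain \<Delta> P \<Gamma>}" "\<Gamma>' \<in> {\<Gamma>. short_antichain \<Delta> P \<Gamma>}"
    "s_region \<Delta> P \<Gamma> = s_region \<Delta> P \<Gamma>'"
  then show "\<Gamma> = \<Gamma>'" using sub[of \<Gamma> \<Gamma>'] sub[of \<Gamma>' \<Gamma>] by auto
qed

lemma exists_minimal_below:
  assumes "J \<subseteq> P" "\<mu> \<in> J"
  shows "\<exists>\<gamma>\<in>J. root_le P \<gamma> \<mu> \<and> (\<forall>\<delta>\<in>J. root_le P \<delta> \<gamma> \<longrightarrow> \<delta> = \<gamma>)"
proof -
  let ?K = "{\<gamma>\<in>J. root_le P \<gamma> \<mu>}"
  have "finite ?K" using assms(1) finite_pos by (auto intro: finite_subset)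
  moreover have "?K \<noteq> {}" using assms(2) root_le_refl by blast
  ultimately obtain \<gamma> where \<gamma>: "\<gamma> \<in> ?K" "\<And>\<delta>. \<delta> \<in> ?K \<Longrightarrow> v \<bullet> \<gamma> \<le> v \<bullet> \<delta>"
    using ex_is_arg_min_if_finite[of ?K "\<lambda>\<gamma>. v \<bullet> \<gamma>"] unfolding is_arg_min_linorder by blast
  have "\<delta> = \<gamma>" if "\<delta> \<in> J" "root_le P \<delta> \<gamma>" for \<delta>
  proof -
    have "\<delta> \<in> ?K" using that \<gamma>(1) root_le_trans by blast
    from \<gamma>(2)[OF this] root_le_imp[OF that(2)] show ?thesis by auto
  qed
  with \<gamma>(1) show ?thesis by blast
qed

text \<open>The antichain consists of the minimal short positive roots with value above 1 at a
  chosen point of \<open>R\<close>. Values at a dominant point grow along the order, so the ideal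
  returns exactly these short roots, and two components sharing a point coincide.\<close>

lemma dominant_region_is_s_region:
  assumes two: "two_root_lengths \<Delta>" and R: "R \<in> dominant_regions \<Delta> P"
  shows "\<exists>\<Gamma>. short_antichain \<Delta> P \<Gamma> \<and> R = s_region \<Delta> P \<Gamma>"
proof -
  have comp: "R \<in> components (UNIV - \<Union>(semi_Catalan \<Delta> P))" and "R \<subseteq> chamber P"
    using R by (auto simp: dominant_regions_def arrangement_regions_def)
  then obtain x where x: "x \<in> R" "x \<in> chamber P" "x \<notin> \<Union>(semi_Catalan \<Delta> P)"
    using in_components_nonempty in_components_subset by (metis DiffE all_not_in_conv subsetD)
  define J where "J = {\<mu>\<in>pos_short \<Delta> P. x \<bullet> \<mu> > 1}"
  define \<Gamma> where "\<Gamma> = {\<gamma>\<in>J. \<forall>\<delta>\<in>J. root_le P \<delta> \<gamma> \<longrightarrow> \<delta> = \<gamma>}"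
  have JP: "J \<subseteq> P" by (auto simp: J_def pos_short_def)
  have anti: "short_antichain \<Delta> P \<Gamma>"
    by (auto simp: short_antichain_def root_antichain_def \<Gamma>_def J_def pos_short_def)
  have ideal: "\<mu> \<in> upper_ideal P \<Gamma> \<longleftrightarrow> x \<bullet> \<mu> > 1" if \<mu>: "\<mu> \<in> pos_short \<Delta> P" for \<mu>
  proof
    assume "\<mu> \<in> upper_ideal P \<Gamma>"
    then obtain \<gamma> where "\<gamma> \<in> J" "root_le P \<gamma> \<mu>" by (auto simp: upper_ideal_def \<Gamma>_def)
    with chamber_inner_mono[OF x(2), of \<gamma> \<mu>] show "x \<bullet> \<mu> > 1" by (simp add: J_def)
  next
    assume "x \<bullet> \<mu> > 1"
    then have "\<mu> \<in> J" using \<mu> by (simp add: J_def)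
    from exists_minimal_below[OF JP this] this JP show "\<mu> \<in> upper_ideal P \<Gamma>"
      unfolding upper_ideal_def \<Gamma>_def by blast
  qed
  have "x \<bullet> \<mu> \<noteq> 1" if "\<mu> \<in> pos_short \<Delta> P" for \<mu>
  proof
    assume "x \<bullet> \<mu> = 1"
    then have "x \<in> root_hyperplane \<mu> 1" by (simp add: root_hyperplane_def)
    moreover have "root_hyperplane \<mu> 1 \<in> semi_Catalan \<Delta> P"
      using that unfolding semi_Catalan_def by blast
    ultimately show False using x(3) by blast
  qed
  with ideal x(2) have "x \<in> s_region \<Delta> P \<Gamma>"
    by (auto simp: s_region_def not_less order.order_iff_strict)
  moreover have "s_region \<Delta> P \<Gamma> \<in> components (UNIV - \<Union>(semi_Catalan \<Delta> P))"
    using s_region_in_dominant_regions[OF two] by (auto simp: dominant_regions_def arrangement_regions_def)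
  ultimately have "R = s_region \<Delta> P \<Gamma>" using components_eq[OF comp] x(1) by blast
  with anti show ?thesis by blast
qed

section \<open>Decomposability of short roots along the order\<close>

text \<open>Short-root form of the fact that a simple reflection permutes the positive roots other
  than its own root. If \<alpha> - \<delta> were positive, the simple root \<alpha> would
  decompose.\<close>

lemma reflection_simple_pos_short:
  assumes \<alpha>: "\<alpha> \<in> simple_roots P" and \<delta>: "\<delta> \<in> pos_short \<Delta> P" and ne: "\<delta> \<noteq> \<alpha>"
  shows "reflection \<alpha> \<delta> \<in> pos_short \<Delta> P"
proof -
  have \<alpha>P: "\<alpha> \<in> P" "\<alpha> \<in> \<Delta>" using \<alpha> simple_pos pos_root by auto
  have \<delta>P: "\<delta> \<in> P" "\<delta> \<in> short_roots \<Delta>" using \<delta> by (auto simp: pos_short_def)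
  have short: "reflection \<alpha> \<delta> \<in> short_roots \<Delta>" by (rule reflection_short[OF \<alpha>P(2) \<delta>P(2)])
  consider "\<delta> \<bullet> \<alpha> = 0" | "\<delta> \<bullet> \<alpha> < 0" | "\<delta> \<bullet> \<alpha> > 0" by linarith
  then show ?thesis
  proof cases
    case 1
    then show ?thesis using \<delta> by (simp add: reflection_def)
  next
    case 2
    have h: "v \<bullet> (\<delta> + \<alpha>) > 0" using pos_height \<alpha>P(1) \<delta>P(1) by (simp add: inner_add_right add_pos_pos)
    have "reflection \<alpha> \<delta> = \<delta> + \<alpha>"
      by (rule reflection_short_eq_add[OF \<delta>P(2) \<alpha>P(2) 2]) (use h in auto)
    with short h short_root[OF short] show ?thesis by (simp add: pos_short_def P_eq)
  next
    case 3
    have "\<alpha> - \<delta> \<notin> P"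
    proof
      assume "\<alpha> - \<delta> \<in> P"
      moreover have "\<alpha> = \<delta> + (\<alpha> - \<delta>)" by simp
      ultimately show False using \<alpha> \<delta>P(1) unfolding simple_roots_def by blast
    qed
    then have "\<delta> - \<alpha> \<in> pos_short \<Delta> P"
      using pos_short_diff[OF \<delta> \<alpha>P(1) 3 ne] by (auto simp: pos_short_def)
    then show ?thesis using reflection_short_eq_diff[OF \<delta>P(2) \<alpha>P(2) 3 ne] by simp
  qed
qed

text \<open>The reflection in \<alpha> sends \<gamma> to \<gamma> + \<alpha> and carries a
  decomposition of \<gamma> to one of the image, provided that neither summand is \<alpha>
  itself.\<close>

lemma short_decomposable_step:
  assumes \<alpha>: "\<alpha> \<in> simple_roots P" and \<gamma>: "\<gamma> \<in> pos_short \<Delta> P - simple_roots (pos_short \<Delta> P)"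
    and neg: "\<gamma> \<bullet> \<alpha> < 0"
  shows "\<gamma> + \<alpha> \<in> pos_short \<Delta> P - simple_roots (pos_short \<Delta> P)"
proof -
  have \<alpha>P: "\<alpha> \<in> P" "\<alpha> \<in> \<Delta>" using \<alpha> simple_pos pos_root by auto
  have \<gamma>P: "\<gamma> \<in> P" "\<gamma> \<in> short_roots \<Delta>" using \<gamma> by (auto simp: pos_short_def)
  obtain \<gamma>1 \<gamma>2 where \<gamma>12: "\<gamma>1 \<in> pos_short \<Delta> P" "\<gamma>2 \<in> pos_short \<Delta> P" "\<gamma> = \<gamma>1 + \<gamma>2"
    using \<gamma> by (auto simp: simple_roots_def)
  \<comment> \<open>If one summand were \<alpha>, this bound on the other would give \<gamma>
    \<bullet> \<alpha> \<ge> 0.\<close>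
  have bound: "- (\<alpha> \<bullet> \<alpha>) \<le> \<delta> \<bullet> \<alpha>" if "\<delta> \<in> pos_short \<Delta> P" for \<delta>
  proof -
    have "norm \<delta> * norm \<alpha> \<le> norm \<alpha> * norm \<alpha>"
      using that \<alpha>P(2) by (auto simp: pos_short_def short_roots_def intro: mult_right_mono)
    with Cauchy_Schwarz_ineq2[of \<delta> \<alpha>] show ?thesis
      by (simp add: power2_norm_eq_inner flip: power2_eq_square)
  qed
  have ne: "\<gamma>1 \<noteq> \<alpha>" "\<gamma>2 \<noteq> \<alpha>"
    using neg bound[OF \<gamma>12(1)] bound[OF \<gamma>12(2)] by (auto simp: \<gamma>12(3) inner_add_left)
  have h: "v \<bullet> (\<gamma> + \<alpha>) > 0" using pos_height \<alpha>P(1) \<gamma>P(1) by (simp add: inner_add_right add_pos_pos)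
  have eq: "reflection \<alpha> \<gamma> = \<gamma> + \<alpha>"
    by (rule reflection_short_eq_add[OF \<gamma>P(2) \<alpha>P(2) neg]) (use h in auto)
  have "\<gamma> \<noteq> \<alpha>" using neg by (metis inner_ge_zero not_less)
  then have "\<gamma> + \<alpha> \<in> pos_short \<Delta> P"
    using reflection_simple_pos_short[OF \<alpha>] \<gamma> eq by force
  moreover have "\<gamma> + \<alpha> = reflection \<alpha> \<gamma>1 + reflection \<alpha> \<gamma>2"
    using eq \<gamma>12(3) reflection_add by metis
  ultimately show ?thesis
    using reflection_simple_pos_short[OF \<alpha>] \<gamma>12 ne unfolding simple_roots_def by blast
qed

text \<open>Some simple root \<alpha> occurring in \<theta> - \<gamma> pairs positively with that
  difference, so either \<gamma> can be raised by \<alpha> or \<theta> lowered by it. In the second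
  case the induction treats \<theta> - \<alpha> and a reflection step returns to \<theta>.\<close>

lemma short_decomposable_upward:
  assumes "root_le P \<gamma> \<theta>"
    and "\<gamma> \<in> pos_short \<Delta> P - simple_roots (pos_short \<Delta> P)" "\<theta> \<in> pos_short \<Delta> P"
  shows "\<theta> \<notin> simple_roots (pos_short \<Delta> P)"
proof -
  obtain M where "set_mset M \<subseteq> simple_roots P" "\<theta> = \<gamma> + \<Sum>\<^sub># M"
    using assms(1) root_le_iff by blast
  then show ?thesis
    using assms(2,3)
  proof (induction "size M" arbitrary: M \<gamma> \<theta>)
    case 0
    then show ?case by simp
  next
    case (Suc n)
    have MP: "set_mset M \<subseteq> P" using Suc.prems simple_pos by auto
    have "M \<noteq> {#}" using Suc.hyps by auto
    then have "\<Sum>\<^sub># M \<noteq> 0" using sum_mset_pos_eq_0[OF MP] by blast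
    then have "(\<Sum>\<alpha>\<in>#M. \<Sum>\<^sub># M \<bullet> \<alpha>) > 0"
      unfolding inner_sum_mset_right[symmetric] by simp
    then obtain \<alpha> where \<alpha>M: "\<alpha> \<in># M" and pos: "\<Sum>\<^sub># M \<bullet> \<alpha> > 0"
      using exists_pos_of_sum_mset_pos by blast
    obtain M' where M: "M = add_mset \<alpha> M'" using \<alpha>M by (metis insert_DiffM)
    have \<alpha>: "\<alpha> \<in> simple_roots P" "\<alpha> \<in> P" using \<alpha>M Suc.prems(1) simple_pos by auto
    have M': "n = size M'" "set_mset M' \<subseteq> simple_roots P" using Suc by (auto simp: M)
    have "\<gamma> \<bullet> \<alpha> < 0 \<or> \<theta> \<bullet> \<alpha> > 0"
      using pos unfolding Suc.prems(2) by (auto simp: inner_add_left)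
    then show ?case
    proof
      assume "\<gamma> \<bullet> \<alpha> < 0"
      then show ?thesis
        using Suc.hyps(1)[OF M', of \<theta> "\<gamma> + \<alpha>"] short_decomposable_step[OF \<alpha>(1) Suc.prems(3)]
          Suc.prems(2,4) by (simp add: M add.assoc)
    next
      assume \<theta>\<alpha>: "\<theta> \<bullet> \<alpha> > 0"
      have ne: "\<theta> \<noteq> \<alpha>"
      proof
        assume "\<theta> = \<alpha>"
        \<comment> \<open>Cancelling \<alpha> would leave \<gamma> and the rest of \<open>M\<close>,
          all positive roots, with sum 0.\<close>
        with Suc.prems(2) have "\<Sum>\<^sub># (add_mset \<gamma> M') = 0" by (simp add: M algebra_simps)
        then have "add_mset \<gamma> M' = {#}"
          by (intro sum_mset_pos_eq_0) (use MP Suc.prems(3) in \<open>auto simp: M pos_short_def\<close>)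
        then show False by simp
      qed
      have eq: "reflection \<alpha> \<theta> = \<theta> - \<alpha>"
        using reflection_short_eq_diff Suc.prems(4) pos_root[OF \<alpha>(2)] \<theta>\<alpha> ne
        by (simp add: pos_short_def)
      have short: "\<theta> - \<alpha> \<in> pos_short \<Delta> P"
        using reflection_simple_pos_short[OF \<alpha>(1) Suc.prems(4) ne] eq by simp
      then have "\<theta> - \<alpha> \<notin> simple_roots (pos_short \<Delta> P)"
        using Suc.hyps(1)[OF M' _ Suc.prems(3)] Suc.prems(2) by (simp add: M)
      moreover have "(\<theta> - \<alpha>) \<bullet> \<alpha> < 0"
        using reflection_inner_root[of \<alpha> \<theta>] \<theta>\<alpha> eq by force
      ultimately show ?thesis
        using short_decomposable_step[OF \<alpha>(1), of "\<theta> - \<alpha>"] short by simp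
    qed
  qed
qed

section \<open>Boundedness of the regions\<close>

text \<open>An element of \<Gamma> below a simple short root would be decomposable, and
  decomposability passes upwards. So simple short roots avoid the ideal, take values between 0 and 1
  on the region, and span.\<close>

lemma bounded_s_region_if_strictly_s_positive:
  assumes "irreducible_roots \<Delta>" and \<Gamma>: "strictly_s_positive \<Delta> P \<Gamma>"
  shows "bounded (s_region \<Delta> P \<Gamma>)"
proof (rule bounded_if_inner_spanning_bounded[OF span_pos_short_simple[OF assms(1)]])
  fix \<theta> assume \<theta>: "\<theta> \<in> simple_roots (pos_short \<Delta> P)"
  then have \<theta>P: "\<theta> \<in> pos_short \<Delta> P" by (simp add: simple_roots_def)
  have "\<theta> \<notin> upper_ideal P \<Gamma>"
    using short_decomposable_upward \<Gamma> \<theta> \<theta>P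
    unfolding strictly_s_positive_def upper_ideal_def by blast
  with \<theta>P have "\<bar>x \<bullet> \<theta>\<bar> \<le> 1" if "x \<in> s_region \<Delta> P \<Gamma>" for x
    using that by (force simp: s_region_def chamber_iff pos_short_def)
  then show "\<exists>K. \<forall>x\<in>s_region \<Delta> P \<Gamma>. \<bar>x \<bullet> \<theta>\<bar> \<le> K" by blast
qed

lemma strictly_s_positive_if_bounded_s_region:
  assumes \<Gamma>: "\<Gamma> \<subseteq> pos_short \<Delta> P" and bounded: "bounded (s_region \<Delta> P \<Gamma>)"
  shows "strictly_s_positive \<Delta> P \<Gamma>"
proof (rule ccontr)
  let ?Y = "pos_short \<Delta> P - upper_ideal P \<Gamma>"
  assume "\<not> strictly_s_positive \<Delta> P \<Gamma>"
  then obtain \<theta> where \<theta>: "\<theta> \<in> \<Gamma>" "\<theta> \<in> simple_roots (pos_short \<Delta> P)"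
    using \<Gamma> by (auto simp: strictly_s_positive_def)
  then have \<theta>P: "\<theta> \<in> pos_short \<Delta> P" "\<theta> \<in> P" using \<Gamma> by (auto simp: pos_short_def)
  have Y: "?Y \<subseteq> P" by (auto simp: pos_short_def)
  \<comment> \<open>A positive product would make \<theta> - \<nu> a short positive root and thus
    decompose \<theta>.\<close>
  have "\<theta> \<bullet> \<nu> \<le> 0" if \<nu>: "\<nu> \<in> ?Y" for \<nu>
  proof (rule ccontr)
    assume "\<not> \<theta> \<bullet> \<nu> \<le> 0"
    then have "\<theta> - \<nu> \<in> pos_short \<Delta> P"
      using pos_short_ideal_diff[of \<theta> \<Gamma> \<nu>] mem_upper_ideal_self \<theta> \<theta>P \<nu> by simp
    moreover have "\<theta> = (\<theta> - \<nu>) + \<nu>" by simp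
    ultimately show False using \<theta>(2) \<nu> unfolding simple_roots_def by blast
  qed
  then obtain y where y: "\<And>\<alpha>. \<alpha> \<in> P \<Longrightarrow> y \<bullet> \<alpha> \<ge> 0" "\<And>\<nu>. \<nu> \<in> ?Y \<Longrightarrow> y \<bullet> \<nu> \<le> 0" "y \<bullet> \<theta> > 0"
    using exists_recession_direction[OF \<theta>P(2) Y _ pos_short_below_ideal_diff] by blast
  obtain x where x: "x \<in> s_region \<Delta> P \<Gamma>" using s_region_nonempty by blast
  have ray: "x + t *\<^sub>R y \<in> s_region \<Delta> P \<Gamma>" if "t \<ge> 0" for t
  proof -
    have up: "(x + t *\<^sub>R y) \<bullet> \<alpha> \<ge> x \<bullet> \<alpha>" if "\<alpha> \<in> P" for \<alpha>
      using y(1)[OF that] \<open>t \<ge> 0\<close> by (simp add: inner_add_left)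
    have down: "(x + t *\<^sub>R y) \<bullet> \<nu> \<le> x \<bullet> \<nu>" if "\<nu> \<in> ?Y" for \<nu>
      using y(2)[OF that] \<open>t \<ge> 0\<close> by (simp add: inner_add_left mult_nonneg_nonpos)
    have "(x + t *\<^sub>R y) \<bullet> \<alpha> > 0" if "\<alpha> \<in> P" for \<alpha>
      by (rule less_le_trans[OF _ up[OF that]]) (use x that in \<open>simp add: s_region_def chamber_iff\<close>)
    moreover have "(x + t *\<^sub>R y) \<bullet> \<mu> > 1" if "\<mu> \<in> upper_ideal P \<Gamma> \<inter> pos_short \<Delta> P" for \<mu>
      by (rule less_le_trans[OF _ up]) (use x that in \<open>auto simp: s_region_def pos_short_def\<close>)
    moreover have "(x + t *\<^sub>R y) \<bullet> \<nu> < 1" if "\<nu> \<in> ?Y" for \<nu>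
      by (rule le_less_trans[OF down[OF that]]) (use x that in \<open>simp add: s_region_def\<close>)
    ultimately show ?thesis unfolding s_region_def chamber_iff by blast
  qed
  obtain K where K: "\<And>z. z \<in> s_region \<Delta> P \<Gamma> \<Longrightarrow> norm z \<le> K"
    using bounded unfolding bounded_iff by blast
  \<comment> \<open>With this \<open>t\<close> the inner product of the ray point with \<theta> is
    \<open>x \<bullet> \<theta> + K * norm \<theta>\<close>, which exceeds the Cauchy-Schwarz bound
    because \<open>x \<bullet> \<theta> > 0\<close>.\<close>
  define t where "t = K * norm \<theta> / (y \<bullet> \<theta>)"
  have "K \<ge> 0" using K[OF x] norm_ge_zero order_trans by blast
  then have t: "t \<ge> 0" using y(3) by (simp add: t_def)
  have "x \<bullet> \<theta> > 0" using x \<theta>P(2) by (simp add: s_region_def chamber_iff)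
  then have "K * norm \<theta> < (x + t *\<^sub>R y) \<bullet> \<theta>" using y(3) by (simp add: t_def inner_add_left)
  also have "\<dots> \<le> norm (x + t *\<^sub>R y) * norm \<theta>" by (rule norm_cauchy_schwarz)
  also have "\<dots> \<le> K * norm \<theta>" using K[OF ray[OF t]] by (simp add: mult_right_mono)
  finally show False by simp
qed

end

theorem theorem6p2:
  fixes \<Delta> P :: "'a::euclidean_space set"
  assumes "root_system \<Delta>" and "crystallographic \<Delta>" and "reduced_roots \<Delta>"
    and "irreducible_roots \<Delta>" and "two_root_lengths \<Delta>"
    and "positive_system \<Delta> P"
  shows "(\<forall>\<Gamma>. short_antichain \<Delta> P \<Gamma> \<longrightarrow> s_region \<Delta> P \<Gamma> \<in> dominant_regions \<Delta> P) \<and>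
    bij_betw (s_region \<Delta> P) {\<Gamma>. short_antichain \<Delta> P \<Gamma>} (dominant_regions \<Delta> P) \<and>
    (\<forall>\<Gamma>. short_antichain \<Delta> P \<Gamma> \<longrightarrow>
      (bounded (s_region \<Delta> P \<Gamma>) \<longleftrightarrow> strictly_s_positive \<Delta> P \<Gamma>))"
proof -
  obtain v where "\<forall>\<alpha>\<in>\<Delta>. v \<bullet> \<alpha> \<noteq> 0" "P = {\<alpha>\<in>\<Delta>. v \<bullet> \<alpha> > 0}"
    using assms(6) by (auto simp: positive_system_def)
  with assms(1,2) interpret positive_roots \<Delta> P v by unfold_locales auto
  have "s_region \<Delta> P ` {\<Gamma>. short_antichain \<Delta> P \<Gamma>} = dominant_regions \<Delta> P"
    using s_region_in_dominant_regions[OF assms(5)] dominant_region_is_s_region[OF assms(5)]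
    by blast
  then have "bij_betw (s_region \<Delta> P) {\<Gamma>. short_antichain \<Delta> P \<Gamma>} (dominant_regions \<Delta> P)"
    using inj_on_s_region by (simp add: bij_betw_def)
  moreover have "bounded (s_region \<Delta> P \<Gamma>) \<longleftrightarrow> strictly_s_positive \<Delta> P \<Gamma>"
    if "short_antichain \<Delta> P \<Gamma>" for \<Gamma>
  proof -
    have "\<Gamma> \<subseteq> pos_short \<Delta> P"
      using that by (auto simp: short_antichain_def root_antichain_def pos_short_def)
    then show ?thesis
      using strictly_s_positive_if_bounded_s_region bounded_s_region_if_strictly_s_positive[OF assms(4)]
      by blast
  qed
  ultimately show ?thesis using s_region_in_dominant_regions[OF assms(5)] by blast
qed

end
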